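(* Let $p\in\mathbb{N}$ be an even integer. Let $f\in C^{p-2}(\mathbb{R},\mathbb{R})$ be a function with absolutely continuous derivative $f^{(p-2)}$, and assume that the weak derivative $f^{(p-1)}$ of $f^{(p-2)}$ is right-continuous and of bounded variation. Then for every $S\in\mathfrak{L}^c_p(\pi)$ and every $t\in[0,T]$, the limit $$\int_0^t f'(S(u))\,dS(u) := \lim_{n\to\infty}\sum_{\substack{[t_j,t_{j+1}]\in\pi_n\\ t_j\le t}}\ \sum_{k=1}^{p-1}\frac{f^{(k)}(S(t_j))}{k!}\,\big(S(t_{j+1})-S(t_j)\big)^k$$ exists, and $$f(S(t))-f(S(0))=\int_0^t f'(S(u))\,dS(u)+\frac{1}{(p-1)!}\int_{\mathbb{R}}L^{p,c}_t(x)\,df^{(p-1)}(x).$$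
   Context: Fix $T>0$ and a nested sequence $\pi=(\pi_n)_{n\in\mathbb{N}}$ of partitions $\pi_n=\{0=t^n_0<\cdots<t^n_{N(\pi_n)}=T\}$ of $[0,T]$. The notation $[t_j,t_{j+1}]\in\pi_n$ means that $t_j<t_{j+1}$ are consecutive elements of $\pi_n$. For $S\in C([0,T],\mathbb{R})$ put $osc(S,\pi_n):=\max_{[t_j,t_{j+1}]\in\pi_n}\max_{r,s\in[t_j,t_{j+1}]}|S(s)-S(r)|$. Write $S_t=S(t)$. $V_p(\pi)$ is the set of $S\in C([0,T],\mathbb{R})$ with $\lim_n osc(S,\pi_n)=0$ such that the measures $\mu^n:=\sum_{[t_j,t_{j+1}]\in\pi_n}|S(t_{j+1})-S(t_j)|^p\,\delta_{t_j}$ converge vaguely to a $\sigma$-finite measure $\mu$ without atoms; $[S]^p(t):=\mu([0,t])$ is the $p$-th variation of $S$. Continuous local time of order $p$: for an even integer $p$, $\mathfrak{L}^c_p(\pi)$ is the set of $S\in V_p(\pi)$ such that $\lim_n osc(S,\pi_n)=0$ and, for each $t\in[0,T]$, the discrete local times $$x\mapsto L^{\pi_n;p}_t(x):=\sum_{[t_j,t_{j+1}]\in\pi_n,\ t_j\le t}\mathbf{1}_{(\min(S_{t_j},S_{t_{j+1}}),\,\max(S_{t_j},S_{t_{j+1}})]}(x)\,|S_{t_{j+1}}-x|^{p-1},\qquad x\in\mathbb{R},$$ converge uniformly in $x$ as $n\to\infty$ to a limit $x\mapsto L^{p,c}_t(x)$, with $(t,x)\mapsto L^{p,c}_t(x)$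 jointly continuous on $[0,T]\times\mathbb{R}$. $L^{p,c}$ is called the order $p$ continuous local time of $S$ along $\pi$. *)

theory Defs
  imports "HOL-Analysis.Analysis"
begin

section \<open>Partitions\<close>

text \<open>Partitions are represented by their finite sets of points; \<open>consecutive P\<close> collects the
  pairs \<open>(t\<^sub>j, t\<^sub>j\<^sub>+\<^sub>1)\<close>, that is, the intervals \<open>[t\<^sub>j, t\<^sub>j\<^sub>+\<^sub>1] \<in> P\<close>.\<close>

definition consecutive :: "real set \<Rightarrow> (real \<times> real) set" where
  "consecutive P = {(u, v). u \<in> P \<and> v \<in> P \<and> u < v \<and> P \<inter> {u<..<v} = {}}"

definition interval_partition :: "real \<Rightarrow> real set \<Rightarrow> bool" where
  "interval_partition T P \<longleftrightarrow> finite P \<and> 0 \<in> P \<and> T \<in> P \<and> P \<subseteq> {0..T}"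

definition nested_partitions :: "real \<Rightarrow> (nat \<Rightarrow> real set) \<Rightarrow> bool" where
  "nested_partitions T \<pi> \<longleftrightarrow> (\<forall>n. interval_partition T (\<pi> n) \<and> \<pi> n \<subseteq> \<pi> (Suc n))"

definition osc :: "(real \<Rightarrow> real) \<Rightarrow> real set \<Rightarrow> real" where
  "osc S P = (MAX (u, v) \<in> consecutive P. SUP (r, s) \<in> {u..v} \<times> {u..v}. \<bar>S s - S r\<bar>)"


section \<open>Paths with \<open>p\<close>-th variation\<close>

text \<open>The discrete measure \<open>\<Sum> |S(t\<^sub>j\<^sub>+\<^sub>1) - S(t\<^sub>j)|\<^sup>p \<delta>(t\<^sub>j)\<close>, as a Borel measure on \<open>[0, T]\<close>: the image
  under \<open>(t\<^sub>j, t\<^sub>j\<^sub>+\<^sub>1) \<mapsto> t\<^sub>j\<close> of the weighted counting measure on the intervals of the partition.\<close>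

definition variation_measure :: "real \<Rightarrow> real set \<Rightarrow> nat \<Rightarrow> (real \<Rightarrow> real) \<Rightarrow> real measure" where
  "variation_measure T P p S =
     distr (point_measure (consecutive P) (\<lambda>(u, v). ennreal (\<bar>S v - S u\<bar> ^ p)))
       (restrict_space borel {0..T}) fst"

text \<open>Vague convergence of Borel measures on \<open>[0, T]\<close>. As \<open>[0, T]\<close> is compact, every continuous
  function on it has compact support. Integrability is required explicitly, since the integral
  of a non-integrable function is \<open>0\<close> by convention.\<close>

definition vague_limit :: "real \<Rightarrow> (nat \<Rightarrow> real measure) \<Rightarrow> real measure \<Rightarrow> bool" where
  "vague_limit T M \<mu> \<longleftrightarrow>
     (\<forall>\<phi> :: real \<Rightarrow> real. continuous_on {0..T} \<phi> \<longrightarrow>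
        (\<forall>n. integrable (M n) \<phi>) \<and> integrable \<mu> \<phi> \<and>
        (\<lambda>n. integral\<^sup>L (M n) \<phi>) \<longlonglongrightarrow> integral\<^sup>L \<mu> \<phi>)"

text \<open>A path in \<open>C([0, T], \<real>)\<close> is a function on \<open>\<real>\<close> of which only the values on \<open>[0, T]\<close> matter.\<close>

definition pth_variation_paths :: "real \<Rightarrow> (nat \<Rightarrow> real set) \<Rightarrow> nat \<Rightarrow> (real \<Rightarrow> real) set" where
  "pth_variation_paths T \<pi> p = {S. continuous_on {0..T} S \<and> (\<lambda>n. osc S (\<pi> n)) \<longlonglongrightarrow> 0 \<and>
     (\<exists>\<mu>. sets \<mu> = sets (restrict_space borel {0..T}) \<and> sigma_finite_measure \<mu> \<and>
          (\<forall>t\<in>{0..T}. emeasure \<mu> {t} = 0) \<and>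
          vague_limit T (\<lambda>n. variation_measure T (\<pi> n) p S) \<mu>)}"


section \<open>Continuous local times\<close>

definition discrete_local_time ::
    "real set \<Rightarrow> nat \<Rightarrow> (real \<Rightarrow> real) \<Rightarrow> real \<Rightarrow> real \<Rightarrow> real" where
  "discrete_local_time P p S t x =
     (\<Sum>(u, v) \<in> {(u, v) \<in> consecutive P. u \<le> t}.
        indicator {min (S u) (S v)<..max (S u) (S v)} x * \<bar>S v - x\<bar> ^ (p - 1))"

definition local_time ::
    "(nat \<Rightarrow> real set) \<Rightarrow> nat \<Rightarrow> (real \<Rightarrow> real) \<Rightarrow> real \<Rightarrow> real \<Rightarrow> real" where
  "local_time \<pi> p S t x = lim (\<lambda>n. discrete_local_time (\<pi> n) p S t x)"

definition continuous_local_time_paths ::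
    "real \<Rightarrow> (nat \<Rightarrow> real set) \<Rightarrow> nat \<Rightarrow> (real \<Rightarrow> real) set" where
  "continuous_local_time_paths T \<pi> p = {S \<in> pth_variation_paths T \<pi> p. (\<lambda>n. osc S (\<pi> n)) \<longlonglongrightarrow> 0 \<and>
     (\<forall>t\<in>{0..T}. uniform_limit UNIV (\<lambda>n. discrete_local_time (\<pi> n) p S t)
                    (local_time \<pi> p S t) sequentially) \<and>
     continuous_on ({0..T} \<times> UNIV) (\<lambda>(t, x). local_time \<pi> p S t x)}"


section \<open>Regularity of the integrand\<close>

definition C_diff :: "nat \<Rightarrow> (real \<Rightarrow> real) \<Rightarrow> bool" where
  "C_diff m f \<longleftrightarrow>
     (\<forall>k<m. \<forall>x. (deriv ^^ k) f differentiable (at x)) \<and> continuous_on UNIV ((deriv ^^ m) f)"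

definition absolutely_continuous_on :: "(real \<Rightarrow> real) \<Rightarrow> real set \<Rightarrow> bool" where
  "absolutely_continuous_on F A \<longleftrightarrow>
     (\<forall>\<epsilon>>0. \<exists>\<delta>>0. \<forall>I. finite I \<and> (\<forall>(u, v)\<in>I. u \<le> v \<and> {u..v} \<subseteq> A) \<and>
        disjoint_family_on (\<lambda>(u, v). {u<..<v}) I \<and> (\<Sum>(u, v)\<in>I. v - u) < \<delta> \<longrightarrow>
        (\<Sum>(u, v)\<in>I. \<bar>F v - F u\<bar>) < \<epsilon>)"

definition test_function :: "(real \<Rightarrow> real) \<Rightarrow> bool" where
  "test_function \<phi> \<longleftrightarrow> (\<forall>m. C_diff m \<phi>) \<and> compact (closure {x. \<phi> x \<noteq> 0})"

definition weak_derivative :: "(real \<Rightarrow> real) \<Rightarrow> (real \<Rightarrow> real) \<Rightarrow> bool" where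
  "weak_derivative F g \<longleftrightarrow>
     (\<forall>a b. set_integrable lborel {a..b} F \<and> set_integrable lborel {a..b} g) \<and>
     (\<forall>\<phi>. test_function \<phi> \<longrightarrow>
        (\<integral>x. F x * deriv \<phi> x \<partial>lborel) = - (\<integral>x. g x * \<phi> x \<partial>lborel))"

definition variation_sum :: "(real \<Rightarrow> real) \<Rightarrow> real set \<Rightarrow> real" where
  "variation_sum g D = (\<Sum>(u, v) \<in> consecutive D. \<bar>g v - g u\<bar>)"

definition bounded_variation_on :: "(real \<Rightarrow> real) \<Rightarrow> real set \<Rightarrow> bool" where
  "bounded_variation_on g A \<longleftrightarrow> bdd_above (variation_sum g ` {D. finite D \<and> D \<subseteq> A})"

definition total_variation :: "(real \<Rightarrow> real) \<Rightarrow> real set \<Rightarrow> real" where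
  "total_variation g A = (SUP D \<in> {D. finite D \<and> D \<subseteq> A}. variation_sum g D)"


section \<open>Integrals\<close>

text \<open>The Lebesgue--Stieltjes integral \<open>\<integral> h dg\<close> over \<open>\<real>\<close> for right-continuous \<open>g\<close> of bounded
  variation, via the Jordan decomposition of \<open>g\<close> into the right-continuous nondecreasing functions
  \<open>(v + g) / 2\<close> and \<open>(v - g) / 2\<close>, where \<open>v x\<close> is the variation of \<open>g\<close> on \<open>(-\<infinity>, x]\<close>.\<close>

definition stieltjes_integral :: "(real \<Rightarrow> real) \<Rightarrow> (real \<Rightarrow> real) \<Rightarrow> real" where
  "stieltjes_integral h g =
     (\<integral>x. h x \<partial>interval_measure (\<lambda>x. (total_variation g {..x} + g x) / 2)) -
     (\<integral>x. h x \<partial>interval_measure (\<lambda>x. (total_variation g {..x} - g x) / 2))"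

text \<open>The derivative \<open>f\<^sup>(\<^sup>k\<^sup>)\<close> for \<open>k \<le> p - 1\<close>: classical for \<open>k < p - 1\<close>, while the one of order \<open>p - 1\<close>
  exists only in the weak sense and is therefore given as a function \<open>g\<close>.\<close>

definition derivative_of_order ::
    "nat \<Rightarrow> (real \<Rightarrow> real) \<Rightarrow> (real \<Rightarrow> real) \<Rightarrow> nat \<Rightarrow> real \<Rightarrow> real" where
  "derivative_of_order p f g k = (if k = p - 1 then g else (deriv ^^ k) f)"

definition compensated_sum ::
    "real set \<Rightarrow> nat \<Rightarrow> (real \<Rightarrow> real) \<Rightarrow> (real \<Rightarrow> real) \<Rightarrow> (real \<Rightarrow> real) \<Rightarrow> real \<Rightarrow> real" where
  "compensated_sum P p f g S t =
     (\<Sum>(u, v) \<in> {(u, v) \<in> consecutive P. u \<le> t}.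
        \<Sum>k = 1..p - 1. derivative_of_order p f g k (S u) / fact k * (S v - S u) ^ k)"

definition pathwise_integral ::
    "(nat \<Rightarrow> real set) \<Rightarrow> nat \<Rightarrow> (real \<Rightarrow> real) \<Rightarrow> (real \<Rightarrow> real) \<Rightarrow> (real \<Rightarrow> real) \<Rightarrow> real \<Rightarrow> real" where
  "pathwise_integral \<pi> p f g S t = lim (\<lambda>n. compensated_sum (\<pi> n) p f g S t)"

end

theory Submission
  imports Defs
begin

text \<open>
  The formula is a Taylor expansion, summed over the intervals of the partition. The expansion of
  \<open>f\<close> at \<open>a\<close> up to order \<open>p - 1\<close> has an error in integral form, and as \<open>g = f\<^sup>(\<^sup>p\<^sup>-\<^sup>1\<^sup>)\<close> is only of
  bounded variation, it is an integral against the measure \<open>dg\<close>. Since \<open>p - 1\<close> is odd, the sign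
  of \<open>(b - x)\<^sup>p\<^sup>-\<^sup>1\<close> cancels the orientation of the interval between \<open>a\<close> and \<open>b\<close>, and the error is
  \<open>1/(p-1)!\<close> times the integral of \<open>1\<^bsub>(min a b, max a b]\<^esub>(x) \<bar>b - x\<bar>\<^sup>p\<^sup>-\<^sup>1\<close> against \<open>dg(x)\<close>
  (\<open>Taylor_formula_local_time_kernel\<close>). With \<open>a = S(t\<^sub>j)\<close> and \<open>b = S(t\<^sub>j\<^sub>+\<^sub>1)\<close> this is the summand of the
  discrete local time. Summation therefore gives an exact identity for each partition: the
  increments of \<open>f \<circ> S\<close> equal the compensated sum plus \<open>1/(p-1)!\<close> times the integral of the discrete
  local time. The increments telescope to \<open>f(S(w)) - f(S(0))\<close> for a point \<open>w\<close> that shares a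
  partition interval with \<open>t\<close>, so they converge to \<open>f(S(t)) - f(S(0))\<close> because the oscillation tends
  to zero (\<open>tendsto_sum_increments_up_to_time\<close>). The integrals of the discrete local times converge
  because \<open>dg\<close> is a difference of two finite measures and the convergence is uniform
  (\<open>tendsto_stieltjes_integral\<close>). Hence the compensated sums converge, and the limit is as claimed.

  Two ingredients need work. First, the weak derivative has to be turned into increments,
  \<open>f\<^sup>(\<^sup>p\<^sup>-\<^sup>2\<^sup>)(b) - f\<^sup>(\<^sup>p\<^sup>-\<^sup>2\<^sup>)(a) = \<integral>\<^sub>a\<^sup>b g\<close>, by testing against smoothed indicators of intervals
  (\<open>weak_derivative_increment\<close>). Taylor's formula (\<open>Taylor_formula_Stieltjes\<close>) then follows by repeated
  integration, where Fubini's theorem raises the power in the error term by one at each step.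
  Second, the variation function of \<open>g\<close> has to be monotone and right-continuous, in order that the
  Jordan decomposition of \<open>g\<close> defines two finite measures whose difference has \<open>g\<close> as its
  distribution function.
\<close>

section \<open>Oriented integrals\<close>

text \<open>The signed indicator for which \<open>\<integral>\<^sub>a\<^sup>b h = \<integral> oriented a b x * h x dx\<close> whatever the order of \<open>a\<close> and \<open>b\<close>,
  so that upward and downward increments of the path are treated alike. The half-open intervals
  \<open>(a, b]\<close> are the ones whose measure under \<open>dg\<close> is \<open>g b - g a\<close> for right-continuous \<open>g\<close>.\<close>

definition oriented :: "real \<Rightarrow> real \<Rightarrow> real \<Rightarrow> real" where
  "oriented a b x = indicator {..b} x - indicator {..a} x"

lemma borel_measurable_oriented [measurable]: "oriented a b \<in> borel_measurable borel"
  unfolding oriented_def[abs_def] by measurable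

lemma oriented_eq:
  "oriented a b x = (if a < x \<and> x \<le> b then 1 else if b < x \<and> x \<le> a then -1 else 0)"
  by (auto simp: oriented_def)

lemma has_bochner_integral_oriented_FTC:
  fixes h H :: "real \<Rightarrow> real"
  assumes H: "\<And>x. (H has_real_derivative h x) (at x)" and h: "continuous_on UNIV h"
  shows "has_bochner_integral lborel (\<lambda>x. oriented a b x * h x) (H b - H a)"
proof -
  have hc: "isCont h x" for x using h by (simp add: continuous_on_eq_continuous_at)
  have [measurable]: "h \<in> borel_measurable borel" using h by (rule borel_measurable_continuous_onI)
  have *: "has_bochner_integral lborel (\<lambda>x. h x * indicator {c..d} x) (H d - H c)" if "c \<le> d" for c d
    using that H hc by (intro has_bochner_integral_FTC_Icc_real) auto
  have eq: "has_bochner_integral lborel (\<lambda>x. oriented a b x * h x) r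
      \<longleftrightarrow> has_bochner_integral lborel k r"
    if "k \<in> borel_measurable borel" "\<And>x. x \<noteq> min a b \<Longrightarrow> oriented a b x * h x = k x" for k r
  proof (rule has_bochner_integral_cong_AE)
    show "AE x in lborel. oriented a b x * h x = k x"
      by (rule AE_mp[OF AE_lborel_singleton[of "min a b"]]) (simp add: that(2))
  qed (use that(1) in simp_all)
  show ?thesis
  proof (cases "a \<le> b")
    case True
    then show ?thesis
      using *[OF True] by (subst eq[of "\<lambda>x. h x * indicator {a..b} x"])
        (auto simp: oriented_eq indicator_def)
  next
    case False
    then have "has_bochner_integral lborel (\<lambda>x. - (h x * indicator {b..a} x)) (H b - H a)"
      using has_bochner_integral_minus[OF *[of b a]] by simp
    then show ?thesis
      using False by (subst eq[of "\<lambda>x. - (h x * indicator {b..a} x)"])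
        (auto simp: oriented_eq indicator_def)
  qed
qed

lemma has_bochner_integral_oriented_power:
  "has_bochner_integral lborel (\<lambda>x. oriented a b x * (x - y) ^ k)
     ((b - y) ^ Suc k / real (Suc k) - (a - y) ^ Suc k / real (Suc k))"
  by (rule has_bochner_integral_oriented_FTC)
    (auto intro!: derivative_eq_intros continuous_intros simp del: of_nat_Suc power_Suc)

section \<open>Smooth test functions\<close>

text \<open>Differentiation changes only the polynomial and the exponent, so it stays inside this family, and
  \<open>bump 1 0\<close> is the standard smooth bump. One derivative formula therefore proves smoothness.\<close>

definition bump :: "real poly \<Rightarrow> nat \<Rightarrow> real \<Rightarrow> real" where
  "bump P k x =
     (if \<bar>x\<bar> < 1 then poly P x / (1 - x\<^sup>2) ^ k * exp (- 1 / (1 - x\<^sup>2)) else 0)"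

text \<open>The exponential dominates the term of order \<open>k + 2\<close> in its power series at \<open>1 / y\<close>.\<close>

lemma exp_minus_inverse_le:
  fixes y :: real
  assumes "0 < y"
  shows "exp (- 1 / y) / y ^ k \<le> fact (k + 2) * y\<^sup>2"
proof -
  have "(\<Sum>n\<in>{k + 2}. (1 / y) ^ n /\<^sub>R fact n) \<le> (\<Sum>n. (1 / y) ^ n /\<^sub>R fact n)"
    using assms by (intro sum_le_suminf summable_exp_generic) auto
  then have "(1 / y) ^ (k + 2) / fact (k + 2) \<le> exp (1 / y)"
    by (simp only: exp_def) (simp add: divide_inverse mult.commute)
  then have "1 \<le> exp (1 / y) * (fact (k + 2) * y ^ (k + 2))"
    using assms
    by (simp only: power_one_over pos_divide_le_eq)
      (simp only: divide_divide_eq_left pos_divide_le_eq zero_less_mult_iff zero_less_power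
        fact_gt_zero mult_ac simp_thms)
  then have "1 / exp (1 / y) \<le> fact (k + 2) * y ^ (k + 2)"
    by (simp add: pos_divide_le_eq mult.commute)
  also have "\<dots> = fact (k + 2) * y\<^sup>2 * y ^ k"
    by (simp only: power_add mult_ac)
  finally show ?thesis
    using assms by (simp add: pos_divide_le_eq exp_minus inverse_eq_divide mult_ac del: fact_Suc)
qed

text \<open>The right-hand side vanishes to second order at \<open>1\<close> and \<open>-1\<close>, which forces the derivative of the
  bump to be zero at these points.\<close>

lemma bump_le:
  "\<exists>C\<ge>0. \<forall>x. \<bar>bump P k x\<bar> \<le> C * (1 - x\<^sup>2)\<^sup>2"
proof -
  have "compact (poly P ` {-1..1})"
    by (intro compact_continuous_image continuous_intros) auto
  then obtain B where B: "\<And>x. x \<in> {-1..1} \<Longrightarrow> \<bar>poly P x\<bar> \<le> B"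
    by (force dest!: compact_imp_bounded simp: bounded_iff)
  have B0: "0 \<le> B" using B[of 0] by auto
  have "\<bar>bump P k x\<bar> \<le> B * fact (k + 2) * (1 - x\<^sup>2)\<^sup>2" for x
  proof (cases "\<bar>x\<bar> < 1")
    case True
    then have y: "0 < 1 - x\<^sup>2" by (simp add: abs_square_less_1)
    have "\<bar>bump P k x\<bar> = \<bar>poly P x\<bar> * (exp (- 1 / (1 - x\<^sup>2)) / (1 - x\<^sup>2) ^ k)"
      using True y by (simp add: bump_def abs_mult)
    also have "\<dots> \<le> B * (fact (k + 2) * (1 - x\<^sup>2)\<^sup>2)"
      using True y B0 by (intro mult_mono B exp_minus_inverse_le) auto
    finally show ?thesis by (simp add: mult.assoc)
  qed (use B0 in \<open>simp add: bump_def\<close>)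
  then show ?thesis using B0 by (intro exI[of _ "B * fact (k + 2)"]) auto
qed

lemma bump_has_derivative:
  "(bump P k has_real_derivative
     bump (pderiv P * [:1, 0, -1:]\<^sup>2 + smult (2 * real k) ([:0, 1:] * P * [:1, 0, -1:])
       - [:0, 2:] * P) (k + 2) x) (at x)"
proof -
  consider "\<bar>x\<bar> < 1" | "\<bar>x\<bar> > 1" | "\<bar>x\<bar> = 1" by linarith
  then show ?thesis
  proof cases
    case 1
    then have y: "0 < 1 - x\<^sup>2" by (simp add: abs_square_less_1)
    have *: "((\<lambda>x. poly P x / (1 - x\<^sup>2) ^ k * exp (- 1 / (1 - x\<^sup>2))) has_real_derivative
      (poly (pderiv P) x * (1 - x\<^sup>2)\<^sup>2 + 2 * real k * (x * poly P x * (1 - x\<^sup>2)) - 2 * x * poly P x)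
       / (1 - x\<^sup>2) ^ (k + 2) * exp (- 1 / (1 - x\<^sup>2))) (at x)"
    proof -
      define z where "z = 1 - x\<^sup>2"
      have z: "z > 0" using y by (simp add: z_def)
      have k: "real k * (1 - x\<^sup>2) ^ (k - Suc 0) = real k * z ^ k / z"
        using z by (cases k) (auto simp: z_def)
      have 1: "((\<lambda>x. (1 - x\<^sup>2) ^ k) has_real_derivative - (2 * x) * (real k * z ^ k / z)) (at x)"
        by (auto intro!: derivative_eq_intros simp: k[symmetric])
      have 2: "((\<lambda>x. exp (- 1 / (1 - x\<^sup>2))) has_real_derivative
          exp (- 1 / z) * (- (2 * x) / z\<^sup>2)) (at x)"
        using z unfolding z_def by (auto intro!: derivative_eq_intros simp: power2_eq_square)
      show ?thesis
      proof (rule DERIV_cong[OF DERIV_mult[OF DERIV_divide[OF poly_DERIV 1] 2]])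
        show "(1 - x\<^sup>2) ^ k \<noteq> 0" using z unfolding z_def[symmetric] by simp
      qed (use z in \<open>unfold z_def[symmetric], simp add: divide_simps power_add,
          simp add: algebra_simps power2_eq_square\<close>)
    qed
    have "((\<lambda>x. poly P x / (1 - x\<^sup>2) ^ k * exp (- 1 / (1 - x\<^sup>2))) has_real_derivative
      bump (pderiv P * [:1, 0, -1:]\<^sup>2 + smult (2 * real k) ([:0, 1:] * P * [:1, 0, -1:])
       - [:0, 2:] * P) (k + 2) x) (at x)"
      using * 1 by (simp add: bump_def algebra_simps power2_eq_square)
    moreover have "\<forall>\<^sub>F y in nhds x. poly P y / (1 - y\<^sup>2) ^ k * exp (- 1 / (1 - y\<^sup>2)) = bump P k y"
      using 1 by (intro eventually_mono[OF eventually_nhds_in_open[of "{-1<..<1}"]])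
        (auto simp: bump_def)
    ultimately show ?thesis
      by (subst (asm) DERIV_cong_ev[OF refl _ refl])
  next
    case 2
    have "((\<lambda>x. 0) has_real_derivative 0) (at x)" by simp
    moreover have "\<forall>\<^sub>F y in nhds x. 0 = bump P k y"
      using 2 by (intro eventually_mono[OF eventually_nhds_in_open[of "- {-1..1}"]])
        (auto simp: bump_def)
    ultimately have "(bump P k has_real_derivative 0) (at x)"
      by (subst (asm) DERIV_cong_ev[OF refl _ refl])
    then show ?thesis using 2 by (simp add: bump_def)
  next
    case 3
    then have x2: "x\<^sup>2 = 1" by (metis one_power2 power2_abs)
    obtain C where C: "C \<ge> 0" "\<And>y. \<bar>bump P k y\<bar> \<le> C * (1 - y\<^sup>2)\<^sup>2"
      using bump_le by blast
    have "((\<lambda>y. C * (\<bar>y - x\<bar> * (x + y)\<^sup>2)) \<longlongrightarrow> C * (\<bar>x - x\<bar> * (x + x)\<^sup>2)) (at x)"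
      by (intro tendsto_intros)
    then have lim: "((\<lambda>y. C * (\<bar>y - x\<bar> * (x + y)\<^sup>2)) \<longlongrightarrow> 0) (at x)" by simp
    have "\<bar>bump P k y / (y - x)\<bar> \<le> C * (\<bar>y - x\<bar> * (x + y)\<^sup>2)" if "y \<noteq> x" for y
    proof -
      have e: "(1 - y\<^sup>2)\<^sup>2 = \<bar>y - x\<bar> * \<bar>y - x\<bar> * (x + y)\<^sup>2"
        unfolding x2[symmetric] by (simp add: power2_eq_square algebra_simps)
      have "\<bar>bump P k y / (y - x)\<bar> = \<bar>bump P k y\<bar> / \<bar>y - x\<bar>" by simp
      also have "\<dots> \<le> C * (1 - y\<^sup>2)\<^sup>2 / \<bar>y - x\<bar>"
        by (intro divide_right_mono C) auto
      also have "\<dots> = C * (\<bar>y - x\<bar> * (x + y)\<^sup>2)"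
        unfolding e using that by (simp del: abs_mult_self_eq)
      finally show ?thesis .
    qed
    then have "((\<lambda>y. bump P k y / (y - x)) \<longlongrightarrow> 0) (at x)"
      by (intro Lim_null_comparison[OF _ lim]) (auto simp: eventually_at_filter)
    then show ?thesis
      using 3 by (simp add: has_field_derivative_iff bump_def)
  qed
qed

lemma deriv_funpow_bump: "\<exists>Q j. (deriv ^^ n) (bump P k) = bump Q j"
proof (induction n)
  case (Suc n)
  then obtain Q j where "(deriv ^^ n) (bump P k) = bump Q j" by blast
  then show ?case
    using DERIV_imp_deriv[OF bump_has_derivative, of Q j]
    by (metis (no_types, lifting) comp_apply funpow.simps(2))
qed auto

definition smooth :: "(real \<Rightarrow> real) \<Rightarrow> bool" where
  "smooth \<phi> \<longleftrightarrow> (\<forall>n x. ((deriv ^^ n) \<phi> has_real_derivative (deriv ^^ Suc n) \<phi> x) (at x))"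

lemma smooth_bump: "smooth (bump P k)"
  unfolding smooth_def
proof (intro allI)
  fix n x
  obtain Q j where *: "(deriv ^^ n) (bump P k) = bump Q j"
    using deriv_funpow_bump by blast
  show "((deriv ^^ n) (bump P k) has_real_derivative (deriv ^^ Suc n) (bump P k) x) (at x)"
    using bump_has_derivative[of Q j x] by (simp add: * DERIV_imp_deriv)
qed

lemma smooth_antiderivative:
  assumes "\<And>x. (R has_real_derivative \<rho> x) (at x)" "smooth \<rho>"
  shows "smooth R"
  unfolding smooth_def
proof (intro allI)
  fix n x
  have "deriv R = \<rho>" using assms(1) by (auto simp: DERIV_imp_deriv)
  then have *: "(deriv ^^ Suc n) R = (deriv ^^ n) \<rho>" for n
    by (simp add: funpow_swap1)
  show "((deriv ^^ n) R has_real_derivative (deriv ^^ Suc n) R x) (at x)"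
  proof (cases n)
    case 0
    then show ?thesis using assms(1) \<open>deriv R = \<rho>\<close> by simp
  next
    case (Suc m)
    show ?thesis unfolding Suc * using assms(2) unfolding smooth_def by blast
  qed
qed

lemma smooth_imp_C_diff:
  assumes "smooth \<phi>" shows "C_diff m \<phi>"
proof -
  have "(deriv ^^ n) \<phi> differentiable (at x)" for n x
    using assms unfolding smooth_def real_differentiable_def by blast
  then show ?thesis
    unfolding C_diff_def
    by (auto intro!: continuous_at_imp_continuous_on differentiable_imp_continuous_within)
qed

text \<open>With a step function \<open>R\<close> and large \<open>s\<close>, this is a smoothed multiple of the oriented indicator of the
  interval from \<open>a\<close> to \<open>b\<close>.\<close>

lemma smooth_diff_affine:
  assumes "smooth R"
  shows "smooth (\<lambda>x. R (s * (x - a)) - R (s * (x - b)))"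
proof -
  define \<psi> where "\<psi> n = (deriv ^^ n) R" for n
  have \<psi>: "(\<psi> n has_real_derivative \<psi> (Suc n) x) (at x)" for n x
    using assms unfolding smooth_def \<psi>_def by blast
  define \<phi> where "\<phi> n x = s ^ n * (\<psi> n (s * (x - a)) - \<psi> n (s * (x - b)))" for n x
  have d: "(\<phi> n has_real_derivative \<phi> (Suc n) x) (at x)" for n x
    unfolding \<phi>_def
    by (rule derivative_eq_intros DERIV_chain2[OF \<psi>] refl)+ (simp add: algebra_simps)
  have "(deriv ^^ n) (\<phi> 0) = \<phi> n" for n
    by (induction n) (auto simp: DERIV_imp_deriv[OF d])
  then have "smooth (\<phi> 0)" unfolding smooth_def using d by (simp del: funpow.simps)
  then show ?thesis by (simp add: \<phi>_def[abs_def] \<psi>_def)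
qed

text \<open>The antiderivative \<open>R\<close> of a bump \<open>\<rho>\<close> climbs from the level \<open>A\<close> to the level \<open>A + K\<close> inside \<open>[-1, 1]\<close>.
  The levels stay unspecified: \<open>A\<close> cancels in differences of translates of \<open>R\<close>, and \<open>K\<close> enters the
  final identity as a common nonzero factor.\<close>

lemma smooth_step_function:
  obtains R \<rho> :: "real \<Rightarrow> real" and A K where
    "smooth R" "\<And>x. (R has_real_derivative \<rho> x) (at x)" "continuous_on UNIV \<rho>"
    "\<And>x. \<bar>x\<bar> > 1 \<Longrightarrow> \<rho> x = 0" "\<And>x. x \<le> -1 \<Longrightarrow> R x = A" "\<And>x. 1 \<le> x \<Longrightarrow> R x = A + K"
    "\<And>x. A \<le> R x \<and> R x \<le> A + K"
    "K > 0" "(\<integral>x. \<rho> x \<partial>lborel) = K"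
proof -
  define \<rho> where "\<rho> = bump 1 0"
  have \<rho>: "smooth \<rho>" "\<And>x. 0 \<le> \<rho> x" "\<And>x. \<bar>x\<bar> \<ge> 1 \<Longrightarrow> \<rho> x = 0" "\<And>x. \<bar>x\<bar> < 1 \<Longrightarrow> 0 < \<rho> x"
    by (auto simp: \<rho>_def smooth_bump) (auto simp: bump_def)
  have cont: "isCont \<rho> x" for x
    unfolding \<rho>_def using bump_has_derivative by (blast intro: DERIV_isCont)
  obtain R where R: "\<And>x. (R has_real_derivative \<rho> x) (at x)"
    using einterval_antiderivative[of "-\<infinity>" "\<infinity>" \<rho>] cont
    by (auto simp: has_real_derivative_iff_has_vector_derivative)
  have mono: "R x \<le> R y" if "x \<le> y" for x y
    using that R \<rho>(2) by (intro DERIV_nonneg_imp_nondecreasing[of x y R]) blast+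
  have left: "R x = R (-1)" if "x \<le> -1" for x
  proof (cases "x < -1")
    case True
    then obtain z where "z < -1" "R (-1) - R x = (-1 - x) * \<rho> z"
      using MVT2[of x "-1" R \<rho>] R by blast
    then show ?thesis using \<rho>(3)[of z] by simp
  qed (use that in auto)
  have right: "R x = R 1" if "1 \<le> x" for x
  proof (cases "1 < x")
    case True
    then obtain z where "z > 1" "R x - R 1 = (x - 1) * \<rho> z"
      using MVT2[of 1 x R \<rho>] R by blast
    then show ?thesis using \<rho>(3)[of z] by simp
  qed (use that in auto)
  obtain z where "0 < z" "z < 1/2" "R (1/2) - R 0 = (1/2 - 0) * \<rho> z"
    using MVT2[of 0 "1/2" R \<rho>] R by auto
  then have "R 0 < R (1/2)" using \<rho>(4)[of z] by simp
  then have pos: "R 1 - R (-1) > 0" using mono[of "-1" 0] mono[of "1/2" 1] by linarith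
  have bounds: "R (-1) \<le> R x \<and> R x \<le> R 1" for x
    using mono[of x 1] mono[of "-1" x] left[of x] right[of x] mono[of "-1" 1] by linarith
  have "(\<integral>x. \<rho> x * indicator {-1..1} x \<partial>lborel) = R 1 - R (-1)"
    by (rule integral_FTC_Icc_real) (use R cont in auto)
  also have "(\<lambda>x. \<rho> x * indicator {-1..1} x) = \<rho>"
    using \<rho>(3) by (force simp: indicator_def)
  finally have "(\<integral>x. \<rho> x \<partial>lborel) = R 1 - R (-1)" .
  show thesis
  proof (rule that[of R \<rho> "R (-1)" "R 1 - R (-1)"])
    show "smooth R" by (rule smooth_antiderivative[OF R \<rho>(1)])
    show "continuous_on UNIV \<rho>" using cont by (auto intro: continuous_at_imp_continuous_on)
    show "R x = R (-1) + (R 1 - R (-1))" if "1 \<le> x" for x using right[OF that] by simp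
    show "R (-1) \<le> R x \<and> R x \<le> R (-1) + (R 1 - R (-1))" for x using bounds[of x] by simp
    show "\<rho> x = 0" if "1 < \<bar>x\<bar>" for x using that by (intro \<rho>(3)) simp
  qed (fact R left pos \<open>(\<integral>x. \<rho> x \<partial>lborel) = R 1 - R (-1)\<close>)+
qed

section \<open>Increments of functions with a weak derivative\<close>

text \<open>The rescaled kernels concentrate at \<open>c\<close>: the substitution \<open>x = c + y / (n + 1)\<close> moves the scaling into
  the continuous function \<open>F\<close>, which is bounded near \<open>c\<close>, so that dominated convergence applies.\<close>

lemma tendsto_integral_rescaled:
  fixes F \<rho> :: "real \<Rightarrow> real"
  assumes F: "continuous_on UNIV F" and \<rho>: "continuous_on UNIV \<rho>"
    and supp: "\<And>y. \<bar>y\<bar> > 1 \<Longrightarrow> \<rho> y = 0"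
  shows "integrable lborel (\<lambda>x. F x * (real (Suc n) * \<rho> (real (Suc n) * (x - c))))"
    and "(\<lambda>n. \<integral>x. F x * (real (Suc n) * \<rho> (real (Suc n) * (x - c))) \<partial>lborel)
      \<longlonglongrightarrow> F c * (\<integral>y. \<rho> y \<partial>lborel)"
proof -
  have mF [measurable]: "F \<in> borel_measurable borel" and m\<rho> [measurable]: "\<rho> \<in> borel_measurable borel"
    using F \<rho> by (auto intro: borel_measurable_continuous_onI)
  have \<rho>_int: "integrable lborel \<rho>"
  proof -
    have "integrable lborel (\<lambda>x. indicator {-1..1} x *\<^sub>R \<rho> x)"
      by (rule borel_integrable_compact) (use \<rho> in \<open>auto intro: continuous_on_subset\<close>)
    also have "(\<lambda>x. indicator {-1..1} x *\<^sub>R \<rho> x) = \<rho>"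
      using supp by (force simp: indicator_def)
    finally show ?thesis .
  qed
  have "compact (F ` {c - 1..c + 1})"
    by (intro compact_continuous_image continuous_on_subset[OF F]) auto
  then obtain B where B: "\<And>x. x \<in> {c - 1..c + 1} \<Longrightarrow> \<bar>F x\<bar> \<le> B"
    by (force dest!: compact_imp_bounded simp: bounded_iff)
  have bound: "\<bar>F (c + y / real (Suc n)) * \<rho> y\<bar> \<le> B * \<bar>\<rho> y\<bar>" for n y
  proof (cases "\<bar>y\<bar> > 1")
    case False
    then have "\<bar>y\<bar> \<le> 1 * real (Suc n)" by simp
    then have "\<bar>y / real (Suc n)\<bar> \<le> 1"
      unfolding abs_divide using pos_divide_le_eq[of "\<bar>real (Suc n)\<bar>" "\<bar>y\<bar>" 1] by simp
    then have "c + y / real (Suc n) \<in> {c - 1..c + 1}"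
      unfolding atLeastAtMost_iff by linarith
    then have "\<bar>F (c + y / real (Suc n))\<bar> \<le> B" by (rule B)
    then show ?thesis by (simp add: abs_mult mult_right_mono)
  qed (simp add: supp)
  have int: "integrable lborel (\<lambda>y. F (c + y / real (Suc n)) * \<rho> y)" for n
    by (rule Bochner_Integration.integrable_bound
          [OF integrable_mult_right[OF integrable_abs[OF \<rho>_int], of B]])
      (use bound in \<open>auto simp del: of_nat_Suc intro!: AE_I2 order.trans[OF bound abs_ge_self]\<close>)
  let ?f = "\<lambda>n x. F x * (real (Suc n) * \<rho> (real (Suc n) * (x - c)))"
  have "has_bochner_integral lborel (?f n) (\<integral>y. F (c + y / real (Suc n)) * \<rho> y \<partial>lborel)" for n
  proof -
    have "has_bochner_integral lborel (\<lambda>y. real (Suc n) * (F (c + y / real (Suc n)) * \<rho> y))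
        (real (Suc n) * (\<integral>y. F (c + y / real (Suc n)) * \<rho> y \<partial>lborel))"
      using int[of n] by (intro has_bochner_integral_mult_right) (simp add: has_bochner_integral_iff)
    then show ?thesis
      by (subst lborel_has_bochner_integral_real_affine_iff[of "1 / real (Suc n)" _ _ c])
        (simp_all add: mult_ac del: of_nat_Suc)
  qed
  then have *: "integrable lborel (?f n)"
    "(\<integral>x. ?f n x \<partial>lborel) = (\<integral>y. F (c + y / real (Suc n)) * \<rho> y \<partial>lborel)" for n
    by (auto simp: has_bochner_integral_iff)
  show "integrable lborel (?f n)" by (rule *)
  have "(\<lambda>n. \<integral>y. F (c + y / real (Suc n)) * \<rho> y \<partial>lborel) \<longlonglongrightarrow> (\<integral>y. F c * \<rho> y \<partial>lborel)"
  proof (rule integral_dominated_convergence)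
    show "integrable lborel (\<lambda>y. B * \<bar>\<rho> y\<bar>)"
      using \<rho>_int by (intro integrable_mult_right integrable_abs)
    have "(\<lambda>n. F (c + y / real (Suc n)) * \<rho> y) \<longlonglongrightarrow> F c * \<rho> y" for y
    proof -
      have "(\<lambda>n. c + y * (1 / real (Suc n))) \<longlonglongrightarrow> c + y * 0"
        by (intro tendsto_intros LIMSEQ_Suc[OF lim_1_over_n])
      then have "(\<lambda>n. c + y / real (Suc n)) \<longlonglongrightarrow> c" by simp
      then show ?thesis
        using F by (intro tendsto_intros isCont_tendsto_compose[of _ F])
          (auto simp: continuous_on_eq_continuous_at)
    qed
    then show "AE y in lborel. (\<lambda>n. F (c + y / real (Suc n)) * \<rho> y) \<longlonglongrightarrow> F c * \<rho> y" by simp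
  qed (use bound in \<open>auto simp del: of_nat_Suc\<close>)
  then show "(\<lambda>n. \<integral>x. ?f n x \<partial>lborel) \<longlonglongrightarrow> F c * (\<integral>y. \<rho> y \<partial>lborel)"
    by (simp add: * del: of_nat_Suc)
qed

text \<open>The test functions \<open>R((n+1)(x - a)) - R((n+1)(x - b))\<close> converge to \<open>K\<close> times the oriented indicator away
  from \<open>a\<close> and \<open>b\<close>, while their derivatives concentrate with mass \<open>K\<close> at \<open>a\<close> and mass \<open>-K\<close> at \<open>b\<close>. The
  defining identity of the weak derivative turns into the claim in the limit. The bound on \<open>g\<close>
  provides the dominating function.\<close>

lemma weak_derivative_increment:
  assumes wd: "weak_derivative F g" and F: "continuous_on UNIV F"
    and g [measurable]: "g \<in> borel_measurable borel" and bd: "\<And>x. \<bar>g x\<bar> \<le> B"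
  shows "has_bochner_integral lborel (\<lambda>x. oriented a b x * g x) (F b - F a)"
proof -
  obtain R \<rho> A K where R: "smooth R" "\<And>x. (R has_real_derivative \<rho> x) (at x)"
    and \<rho>: "continuous_on UNIV \<rho>" "\<And>x. \<bar>x\<bar> > 1 \<Longrightarrow> \<rho> x = 0"
    and RA: "\<And>x. x \<le> -1 \<Longrightarrow> R x = A" "\<And>x. 1 \<le> x \<Longrightarrow> R x = A + K" "\<And>x. A \<le> R x \<and> R x \<le> A + K"
    and K: "K > 0" "(\<integral>x. \<rho> x \<partial>lborel) = K"
    using smooth_step_function by blast
  define \<phi> where "\<phi> n x = R (real (Suc n) * (x - a)) - R (real (Suc n) * (x - b))" for n x
  have Rm [measurable]: "R \<in> borel_measurable borel"
    using R(2) by (auto intro!: borel_measurable_continuous_onI continuous_at_imp_continuous_on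
        intro: DERIV_isCont)
  have \<phi>m [measurable]: "\<phi> n \<in> borel_measurable borel" for n
    unfolding \<phi>_def[abs_def] by measurable
  let ?I = "{min a b - 1..max a b + 1}"
  have \<phi>0: "\<phi> n x = 0" if "x \<notin> ?I" for n x
  proof -
    \<comment> \<open>Outside this interval both arguments of \<open>R\<close> lie beyond the same end of \<open>[-1, 1]\<close>.\<close>
    have *: "1 \<le> real (Suc n) * y" if "1 \<le> y" for y
      using mult_mono[of 1 "real (Suc n)" 1 y] that by simp
    have **: "real (Suc n) * y \<le> -1" if "y \<le> -1" for y
      using *[of "-y"] that by simp
    from that consider "x - a \<le> -1" "x - b \<le> -1" | "x - a \<ge> 1" "x - b \<ge> 1"
      by (auto simp: min_def max_def split: if_splits)
    then show ?thesis
      by cases (use * ** in \<open>auto simp: \<phi>_def RA simp del: of_nat_Suc\<close>)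
  qed
  have test: "test_function (\<phi> n)" for n
  proof -
    have "smooth (\<phi> n)"
      unfolding \<phi>_def by (rule smooth_diff_affine) (rule R)
    moreover have "bounded {x. \<phi> n x \<noteq> 0}"
      by (rule bounded_subset[of ?I]) (simp, use \<phi>0 in blast)
    ultimately show ?thesis
      by (simp add: test_function_def smooth_imp_C_diff compact_closure)
  qed
  define J where "J c n = (\<integral>x. F x * (real (Suc n) * \<rho> (real (Suc n) * (x - c))) \<partial>lborel)" for c n
  have J: "J c \<longlonglongrightarrow> F c * K" for c
    using tendsto_integral_rescaled(2)[OF F \<rho>] by (simp add: J_def[abs_def] K)
  have "deriv (\<phi> n) x = real (Suc n) * \<rho> (real (Suc n) * (x - a))
      - real (Suc n) * \<rho> (real (Suc n) * (x - b))" for n x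
    unfolding \<phi>_def
    by (rule DERIV_imp_deriv) (rule derivative_eq_intros DERIV_chain2[OF R(2)] refl | simp)+
  then have "(\<integral>x. F x * deriv (\<phi> n) x \<partial>lborel) = J a n - J b n" for n
    unfolding J_def
    by (simp only: right_diff_distrib[of "F _"]
        Bochner_Integration.integral_diff[OF tendsto_integral_rescaled(1)[OF F \<rho>]
          tendsto_integral_rescaled(1)[OF F \<rho>]])
  then have "(\<integral>x. g x * \<phi> n x \<partial>lborel) = J b n - J a n" for n
  proof -
    from wd test[of n] have "(\<integral>x. F x * deriv (\<phi> n) x \<partial>lborel) = - (\<integral>x. g x * \<phi> n x \<partial>lborel)"
      unfolding weak_derivative_def by blast
    then show ?thesis using \<open>(\<integral>x. F x * deriv (\<phi> n) x \<partial>lborel) = J a n - J b n\<close> by linarith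
  qed
  moreover have "(\<lambda>n. J b n - J a n) \<longlonglongrightarrow> F b * K - F a * K"
    by (intro tendsto_intros J)
  ultimately have lim1: "(\<lambda>n. \<integral>x. g x * \<phi> n x \<partial>lborel) \<longlonglongrightarrow> (F b - F a) * K"
    by (simp add: left_diff_distrib)
  have lim2: "(\<lambda>n. \<integral>x. g x * \<phi> n x \<partial>lborel) \<longlonglongrightarrow> (\<integral>x. g x * (oriented a b x * K) \<partial>lborel)"
    and int: "integrable lborel (\<lambda>x. g x * (oriented a b x * K))"
  proof -
    have bdd: "\<bar>g x * \<phi> n x\<bar> \<le> B * K * indicator ?I x" for n x
    proof (cases "x \<in> ?I")
      case True
      have "\<bar>\<phi> n x\<bar> \<le> K"
        using RA(3)[of "real (Suc n) * (x - a)"] RA(3)[of "real (Suc n) * (x - b)"]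
        unfolding \<phi>_def by linarith
      then show ?thesis
        using True bd[of x] K by (auto simp: abs_mult intro!: mult_mono)
    qed (simp add: \<phi>0)
    \<comment> \<open>The constants \<open>A + K\<close> cancel in the difference of the limits for \<open>c = a\<close> and \<open>c = b\<close>.\<close>
    have step: "(\<lambda>n. R (real (Suc n) * (x - c))) \<longlonglongrightarrow> A + K - K * indicator {..c} x" if "x \<noteq> c" for x c
    proof -
      obtain N where N: "1 / \<bar>x - c\<bar> < real N" using reals_Archimedean2 by blast
      have 1: "1 \<le> real (Suc n) * \<bar>x - c\<bar>" if "n \<ge> N" for n
      proof -
        have "1 / \<bar>x - c\<bar> \<le> real (Suc n)" using N that by linarith
        then show ?thesis using \<open>x \<noteq> c\<close> by (simp add: divide_simps)
      qed
      have "R (real (Suc n) * (x - c)) = A + K - K * indicator {..c} x" if "n \<ge> N" for n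
      proof (cases "x < c")
        case True
        then show ?thesis using 1[OF that] by (simp add: RA algebra_simps)
      next
        case False
        then show ?thesis using 1[OF that] \<open>x \<noteq> c\<close> by (simp add: RA algebra_simps)
      qed
      then show ?thesis
        by (intro tendsto_eventually) (auto simp: eventually_sequentially)
    qed
    have "(\<lambda>n. g x * \<phi> n x) \<longlonglongrightarrow> g x * (oriented a b x * K)" if "x \<noteq> a" "x \<noteq> b" for x
    proof -
      have "(\<lambda>n. g x * \<phi> n x) \<longlonglongrightarrow>
         g x * ((A + K - K * indicator {..a} x) - (A + K - K * indicator {..b} x))"
        unfolding \<phi>_def by (intro tendsto_intros step that)
      then show ?thesis by (simp add: oriented_def algebra_simps)
    qed
    then have AE: "AE x in lborel. (\<lambda>n. g x * \<phi> n x) \<longlonglongrightarrow> g x * (oriented a b x * K)"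
      using AE_lborel_singleton[of a] AE_lborel_singleton[of b] by (auto elim: AE_mp)
    have I: "integrable lborel (\<lambda>x. B * K * indicator ?I x)"
      by (intro integrable_mult_right integrable_real_indicator) auto
    show "(\<lambda>n. \<integral>x. g x * \<phi> n x \<partial>lborel) \<longlonglongrightarrow> (\<integral>x. g x * (oriented a b x * K) \<partial>lborel)"
      by (rule integral_dominated_convergence[OF _ _ I AE]) (use bdd in auto)
    show "integrable lborel (\<lambda>x. g x * (oriented a b x * K))"
      by (rule integrable_dominated_convergence[OF _ _ I AE]) (use bdd in auto)
  qed
  have e: "g x * (oriented a b x * K) = K * (oriented a b x * g x)" for x by simp
  have "K * (\<integral>x. oriented a b x * g x \<partial>lborel) = K * (F b - F a)"
    using LIMSEQ_unique[OF lim1 lim2] unfolding e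
    by (simp only: Bochner_Integration.integral_mult_right_zero mult.commute)
  moreover have "integrable lborel (\<lambda>x. oriented a b x * g x)"
    using int K unfolding e by simp
  ultimately show ?thesis using K by (simp add: has_bochner_integral_iff)
qed

section \<open>Taylor's formula with an error term in Stieltjes form\<close>

text \<open>For \<open>x \<noteq> y\<close>, the point \<open>x\<close> lies between \<open>a\<close> and \<open>b\<close> with \<open>y\<close> between \<open>a\<close> and \<open>x\<close> exactly if \<open>y\<close> lies
  between \<open>a\<close> and \<open>b\<close> with \<open>x\<close> between \<open>y\<close> and \<open>b\<close>. This exchange of the order of integration, with
  signs, leaves the integral of a power from \<open>y\<close> to \<open>b\<close>.\<close>

lemma integral_oriented_twice:
  "(\<integral>x. oriented a b x * (oriented a x y * (x - y) ^ q) \<partial>lborel)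
     = oriented a b y * (b - y) ^ Suc q / real (Suc q)"
proof -
  have "oriented a b x * (oriented a x y * (x - y) ^ q)
      = oriented a b y * (oriented y b x * (x - y) ^ q)" if "x \<noteq> y" for x
    using that by (auto simp: oriented_eq)
  then have "AE x in lborel. oriented a b x * (oriented a x y * (x - y) ^ q)
      = oriented a b y * (oriented y b x * (x - y) ^ q)"
    using AE_lborel_singleton[of y] by (auto elim: AE_mp)
  moreover have "(\<lambda>x. oriented a x y) \<in> borel_measurable borel"
  proof -
    have "(\<lambda>x. oriented a x y) = (\<lambda>x. indicator {y..} x - indicator {..a} y)"
      by (auto simp: oriented_def fun_eq_iff split: split_indicator)
    then show ?thesis by simp
  qed
  ultimately have "(\<integral>x. oriented a b x * (oriented a x y * (x - y) ^ q) \<partial>lborel)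
      = (\<integral>x. oriented a b y * (oriented y b x * (x - y) ^ q) \<partial>lborel)"
    by (intro integral_cong_AE) auto
  also have "\<dots> = oriented a b y * ((b - y) ^ Suc q / real (Suc q))"
    using has_bochner_integral_oriented_power[of y b y q]
    by (simp add: has_bochner_integral_iff)
  finally show ?thesis by simp
qed

text \<open>For a function whose derivative of order \<open>q\<close> is the distribution function of \<open>M\<close>, this is \<open>q!\<close> times
  the error at \<open>b\<close> of its Taylor polynomial of degree \<open>q\<close> at \<open>a\<close>.\<close>

definition Taylor_remainder :: "real measure \<Rightarrow> real \<Rightarrow> nat \<Rightarrow> real \<Rightarrow> real" where
  "Taylor_remainder M a q b = (\<integral>y. oriented a b y * (b - y) ^ q \<partial>M)"

text \<open>Fubini's theorem reduces the claim to a single point mass at \<open>y\<close>. It is applicable because the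
  integrand lives on a bounded range of \<open>x\<close>, where its modulus is at most \<open>\<bar>b - a\<bar>\<^sup>q\<close>, and \<open>M\<close> is finite.\<close>

lemma has_bochner_integral_Taylor_remainder:
  assumes M: "finite_measure M" and [measurable_cong]: "sets M = sets borel"
  shows "has_bochner_integral lborel (\<lambda>x. oriented a b x * Taylor_remainder M a q x)
           (Taylor_remainder M a (Suc q) b / real (Suc q))"
proof -
  interpret M: finite_measure M by fact
  interpret pair_sigma_finite lborel M ..
  have m [measurable]: "(\<lambda>z. oriented a (fst z) (snd z)) \<in> borel_measurable (lborel \<Otimes>\<^sub>M M)"
  proof -
    have "oriented a (fst z) (snd z) = (if snd z \<le> fst z then 1 else 0) - indicator {..a} (snd z)"
      for z :: "real \<times> real" by (auto simp: oriented_def)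
    then show ?thesis by simp
  qed
  let ?f = "\<lambda>x y. oriented a b x * (oriented a x y * (x - y) ^ q)"
  have "integrable (lborel \<Otimes>\<^sub>M M) (\<lambda>z. indicator ({min a b..max a b} \<times> space M) z *\<^sub>R \<bar>b - a\<bar> ^ q)"
    by (intro integrable_indicator)
      (auto simp: M.emeasure_pair_measure_Times M.emeasure_eq_measure ennreal_mult_less_top)
  then have int: "integrable (lborel \<Otimes>\<^sub>M M) (\<lambda>(x, y). ?f x y)"
  proof (rule Bochner_Integration.integrable_bound)
    show "(\<lambda>(x, y). ?f x y) \<in> borel_measurable (lborel \<Otimes>\<^sub>M M)"
      unfolding split_beta' by measurable
    have "\<bar>?f x y\<bar> \<le> indicator {min a b..max a b} x * \<bar>b - a\<bar> ^ q" for x y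
    proof (cases "oriented a b x = 0 \<or> oriented a x y = 0")
      case False
      then have "\<bar>x - y\<bar> \<le> \<bar>b - a\<bar>" "x \<in> {min a b..max a b}"
        by (auto simp: oriented_eq split: if_splits)
      moreover have "\<bar>?f x y\<bar> = \<bar>x - y\<bar> ^ q"
        using False by (auto simp: oriented_eq abs_mult power_abs split: if_splits)
      ultimately show ?thesis by (simp add: power_mono)
    qed auto
    then show "AE z in lborel \<Otimes>\<^sub>M M. norm ((\<lambda>(x, y). ?f x y) z)
        \<le> norm (indicator ({min a b..max a b} \<times> space M) z *\<^sub>R \<bar>b - a\<bar> ^ q)"
      by (intro AE_I2) (auto simp: space_pair_measure indicator_times)
  qed
  have inner: "(\<integral>y. ?f x y \<partial>M) = oriented a b x * Taylor_remainder M a q x" for x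
    by (simp add: Taylor_remainder_def)
  have "integrable lborel (\<lambda>x. \<integral>y. ?f x y \<partial>M)"
    using integrable_fst'[OF int] by simp
  moreover have "(\<integral>x. (\<integral>y. ?f x y \<partial>M) \<partial>lborel) = (\<integral>y. (\<integral>x. ?f x y \<partial>lborel) \<partial>M)"
    using Fubini_integral[OF int] by simp
  moreover have "(\<integral>y. (\<integral>x. ?f x y \<partial>lborel) \<partial>M) = Taylor_remainder M a (Suc q) b / real (Suc q)"
    unfolding integral_oriented_twice Taylor_remainder_def by simp
  ultimately show ?thesis
    unfolding inner by (simp add: has_bochner_integral_iff)
qed

text \<open>The sequence \<open>D\<close> lists the derivatives from the highest one downwards, each being an antiderivative of
  its predecessor, so that the induction integrates the expansion term by term. Integration is all
  it uses, so it can start from a function \<open>D 0\<close> that is merely the difference of two distribution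
  functions.\<close>

lemma Taylor_formula_Stieltjes:
  assumes M: "finite_measure M" "sets M = sets borel" and N: "finite_measure N" "sets N = sets borel"
    and D0: "\<And>a b. D 0 b - D 0 a = Taylor_remainder M a 0 b - Taylor_remainder N a 0 b"
    and D: "\<And>i a b. i < q \<Longrightarrow>
      has_bochner_integral lborel (\<lambda>x. oriented a b x * D i x) (D (Suc i) b - D (Suc i) a)"
  shows "D q b = (\<Sum>k\<le>q. D (q - k) a / fact k * (b - a) ^ k)
      + (Taylor_remainder M a q b - Taylor_remainder N a q b) / fact q"
  using D
proof (induction q arbitrary: b)
  case 0
  then show ?case using D0[of b a] by simp
next
  case (Suc q)
  let ?R = "\<lambda>q x. Taylor_remainder M a q x - Taylor_remainder N a q x"
  have "has_bochner_integral lborel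
    (\<lambda>x. (\<Sum>k\<le>q. D (q - k) a / fact k * (oriented a b x * (x - a) ^ k))
      + (oriented a b x * Taylor_remainder M a q x - oriented a b x * Taylor_remainder N a q x) / fact q)
    ((\<Sum>k\<le>q. D (q - k) a / fact k * ((b - a) ^ Suc k / real (Suc k)
          - (a - a) ^ Suc k / real (Suc k)))
      + (Taylor_remainder M a (Suc q) b / real (Suc q)
          - Taylor_remainder N a (Suc q) b / real (Suc q)) / fact q)"
    by (intro has_bochner_integral_add has_bochner_integral_sum has_bochner_integral_mult_right
        has_bochner_integral_divide_zero has_bochner_integral_diff
        has_bochner_integral_oriented_power has_bochner_integral_Taylor_remainder M N)
  also have "(\<lambda>x. (\<Sum>k\<le>q. D (q - k) a / fact k * (oriented a b x * (x - a) ^ k))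
      + (oriented a b x * Taylor_remainder M a q x - oriented a b x * Taylor_remainder N a q x) / fact q)
    = (\<lambda>x. oriented a b x * D q x)"
  proof
    fix x
    have "D q x = (\<Sum>k\<le>q. D (q - k) a / fact k * (x - a) ^ k) + ?R q x / fact q"
      by (rule Suc.IH) (use Suc.prems in auto)
    then show "(\<Sum>k\<le>q. D (q - k) a / fact k * (oriented a b x * (x - a) ^ k))
      + (oriented a b x * Taylor_remainder M a q x - oriented a b x * Taylor_remainder N a q x) / fact q
      = oriented a b x * D q x"
      by (simp add: sum_distrib_left distrib_left right_diff_distrib diff_divide_distrib mult_ac)
  qed
  finally have "D (Suc q) b - D (Suc q) a
      = (\<Sum>k\<le>q. D (q - k) a / fact k * ((b - a) ^ Suc k / real (Suc k)
          - (a - a) ^ Suc k / real (Suc k)))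
      + (Taylor_remainder M a (Suc q) b / real (Suc q)
          - Taylor_remainder N a (Suc q) b / real (Suc q)) / fact q"
    using Suc.prems[of q a b] has_bochner_integral_eq by blast
  also have "(\<Sum>k\<le>q. D (q - k) a / fact k * ((b - a) ^ Suc k / real (Suc k)
          - (a - a) ^ Suc k / real (Suc k)))
      = (\<Sum>k\<le>q. D (Suc q - Suc k) a / fact (Suc k) * (b - a) ^ Suc k)"
    by (intro sum.cong) (simp_all add: mult_ac)
  also have "(Taylor_remainder M a (Suc q) b / real (Suc q)
          - Taylor_remainder N a (Suc q) b / real (Suc q)) / fact q
      = ?R (Suc q) b / fact (Suc q)"
    by (simp add: diff_divide_distrib mult_ac)
  finally show ?case
    unfolding sum.atMost_Suc_shift by simp
qed

section \<open>Sums over the intervals of a partition\<close>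

lemma finite_consecutive [simp]: "finite P \<Longrightarrow> finite (consecutive P)"
  by (rule finite_subset[of _ "P \<times> P"]) (auto simp: consecutive_def)

lemma consecutive_split:
  assumes "c \<in> P"
  shows "consecutive P = consecutive (P \<inter> {..c}) \<union> consecutive (P \<inter> {c..})"
    and "consecutive (P \<inter> {..c}) \<inter> consecutive (P \<inter> {c..}) = {}"
proof -
  show "consecutive P = consecutive (P \<inter> {..c}) \<union> consecutive (P \<inter> {c..})"
  proof (intro equalityI subsetI)
    fix z assume "z \<in> consecutive P"
    then obtain u v where z: "z = (u, v)" "u \<in> P" "v \<in> P" "u < v" "P \<inter> {u<..<v} = {}"
      by (auto simp: consecutive_def)
    then have "v \<le> c \<or> c \<le> u" using assms by force
    then show "z \<in> consecutive (P \<inter> {..c}) \<union> consecutive (P \<inter> {c..})"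
      using z by (auto simp: consecutive_def)
  next
    fix z assume "z \<in> consecutive (P \<inter> {..c}) \<union> consecutive (P \<inter> {c..})"
    then show "z \<in> consecutive P"
      by (auto simp: consecutive_def)
  qed
qed (auto simp: consecutive_def)

lemma sum_consecutive_split:
  fixes h :: "real \<Rightarrow> real \<Rightarrow> real"
  assumes "finite P" "c \<in> P"
  shows "(\<Sum>(u, v)\<in>consecutive P. h u v)
    = (\<Sum>(u, v)\<in>consecutive (P \<inter> {..c}). h u v) + (\<Sum>(u, v)\<in>consecutive (P \<inter> {c..}). h u v)"
  using assms consecutive_split[OF assms(2)] by (simp add: sum.union_disjoint)

lemma consecutive_pair: "x < y \<Longrightarrow> consecutive {x, y} = {(x, y)}"
  by (auto simp: consecutive_def)

lemma sum_consecutive_telescope: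
  fixes h :: "real \<Rightarrow> real"
  assumes "finite P" "P \<noteq> {}"
  shows "(\<Sum>(u, v)\<in>consecutive P. h v - h u) = h (Max P) - h (Min P)"
  using assms
proof (induction P rule: finite_linorder_max_induct)
  case (insert b A)
  show ?case
  proof (cases "A = {}")
    case True
    then have "consecutive (insert b A) = {}" by (auto simp: consecutive_def)
    then show ?thesis using True by simp
  next
    case False
    define m where "m = Max A"
    have m: "m \<in> A" "\<And>a. a \<in> A \<Longrightarrow> a \<le> m" using insert False by (auto simp: m_def)
    have mb: "m < b" using insert m by auto
    have 1: "insert b A \<inter> {..m} = A" using m mb by auto
    have 2: "insert b A \<inter> {m..} = {m, b}" using m mb by force
    have "(\<Sum>(u, v)\<in>consecutive (insert b A). h v - h u) = (h m - h (Min A)) + (h b - h m)"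
      using sum_consecutive_split[of "insert b A" m "\<lambda>u v. h v - h u"] insert False m mb
      unfolding 1 2 consecutive_pair[OF mb] by (simp flip: m_def)
    moreover have "Max (insert b A) = b" "Min (insert b A) = Min A"
    proof -
      show "Max (insert b A) = b" using insert by (auto intro!: Max_eqI simp: less_imp_le)
      have "Min A \<le> b" using Min_le[OF insert.hyps(1) m(1)] mb by linarith
      then show "Min (insert b A) = Min A" using insert.hyps(1) False by (simp add: min_absorb2)
    qed
    ultimately show ?thesis by simp
  qed
qed simp

section \<open>The variation function\<close>

lemma variation_sum_split:
  assumes "finite D" "c \<in> D"
  shows "variation_sum g D = variation_sum g (D \<inter> {..c}) + variation_sum g (D \<inter> {c..})"
  unfolding variation_sum_def using sum_consecutive_split[OF assms, of "\<lambda>u v. \<bar>g v - g u\<bar>"] .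

lemma variation_sum_nonneg: "0 \<le> variation_sum g D"
  unfolding variation_sum_def by (intro sum_nonneg) auto

text \<open>If \<open>c\<close> falls inside an interval, the triangle inequality applies there; otherwise all intervals
  survive.\<close>

lemma variation_sum_insert:
  assumes "finite D"
  shows "variation_sum g D \<le> variation_sum g (insert c D)"
proof (cases "\<exists>(u, v)\<in>consecutive D. u < c \<and> c < v")
  case True
  then obtain u v where uv: "(u, v) \<in> consecutive D" "u < c" "c < v" by auto
  then have *: "consecutive (insert c D) \<supseteq> (consecutive D - {(u, v)}) \<union> {(u, c), (c, v)}"
    by (fastforce simp: consecutive_def)
  have c: "c \<notin> D" using uv by (auto simp: consecutive_def)
  have "variation_sum g D = \<bar>g v - g u\<bar> + (\<Sum>(u, v)\<in>consecutive D - {(u, v)}. \<bar>g v - g u\<bar>)"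
    unfolding variation_sum_def using assms uv by (simp add: sum.remove)
  also have "\<dots> \<le> (\<Sum>(u, v)\<in>{(u, c), (c, v)}. \<bar>g v - g u\<bar>) + (\<Sum>(u, v)\<in>consecutive D - {(u, v)}. \<bar>g v - g u\<bar>)"
    using uv by simp
  also have "\<dots> = (\<Sum>(u, v)\<in>{(u, c), (c, v)} \<union> (consecutive D - {(u, v)}). \<bar>g v - g u\<bar>)"
    using c finite_consecutive[OF assms] by (intro sum.union_disjoint[symmetric])
      (simp_all, auto simp: consecutive_def)
  also have "\<dots> \<le> variation_sum g (insert c D)"
    unfolding variation_sum_def using assms * by (intro sum_mono2) auto
  finally show ?thesis .
next
  case False
  then have "consecutive D \<subseteq> consecutive (insert c D)"
    by (auto simp: consecutive_def)
  then show ?thesis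
    unfolding variation_sum_def using assms by (intro sum_mono2) auto
qed

lemma variation_sum_le_total_variation:
  assumes "bounded_variation_on g UNIV" "finite D" "D \<subseteq> A"
  shows "variation_sum g D \<le> total_variation g A"
proof -
  have "bdd_above (variation_sum g ` {D. finite D \<and> D \<subseteq> A})"
    using assms(1) unfolding bounded_variation_on_def by (rule bdd_above_mono) auto
  then show ?thesis
    unfolding total_variation_def using assms by (intro cSUP_upper) auto
qed

text \<open>A set of points below \<open>x\<close> can be joined to \<open>D\<close> at \<open>x\<close>. With \<open>D = {x, y}\<close> this makes the Jordan
  parts monotone; in general it bounds the variation that is left to the right of a point.\<close>

lemma total_variation_superadditive:
  assumes bv: "bounded_variation_on g UNIV" and "x \<le> y"
    and D: "finite D" "D \<subseteq> {x..y}" "x \<in> D"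
  shows "total_variation g {..x} + variation_sum g D \<le> total_variation g {..y}"
proof -
  have "variation_sum g E \<le> total_variation g {..y} - variation_sum g D"
    if E: "finite E" "E \<subseteq> {..x}" for E
  proof -
    have "(insert x E \<union> D) \<inter> {..x} = insert x E" "(insert x E \<union> D) \<inter> {x..} = D"
      using E D by auto
    then have "variation_sum g (insert x E \<union> D) = variation_sum g (insert x E) + variation_sum g D"
      using variation_sum_split[of "insert x E \<union> D" x g] E D by simp
    moreover have "variation_sum g (insert x E \<union> D) \<le> total_variation g {..y}"
      by (rule variation_sum_le_total_variation[OF bv]) (use E D \<open>x \<le> y\<close> in auto)
    ultimately show ?thesis using variation_sum_insert[OF E(1), of g x] by linarith
  qed
  then have "total_variation g {..x} \<le> total_variation g {..y} - variation_sum g D"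
    unfolding total_variation_def[of g "{..x}"] by (intro cSUP_least) auto
  then show ?thesis by simp
qed

lemma abs_diff_le_total_variation:
  assumes "bounded_variation_on g UNIV" "x \<le> y"
  shows "\<bar>g y - g x\<bar> \<le> total_variation g {..y} - total_variation g {..x}"
proof (cases "x = y")
  case False
  then have "variation_sum g {x, y} = \<bar>g y - g x\<bar>"
    using assms by (simp add: variation_sum_def consecutive_pair)
  then show ?thesis
    using total_variation_superadditive[of g x y "{x, y}"] assms by auto
qed simp

lemma total_variation_bounds:
  assumes "bounded_variation_on g UNIV"
  shows "0 \<le> total_variation g {..x}" "total_variation g {..x} \<le> total_variation g UNIV"
proof -
  show "0 \<le> total_variation g {..x}"
    using variation_sum_le_total_variation[OF assms, of "{}" "{..x}"] variation_sum_nonneg[of g "{}"]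
    by simp
  show "total_variation g {..x} \<le> total_variation g UNIV"
    unfolding total_variation_def[of g "{..x}"]
    by (intro cSUP_least variation_sum_le_total_variation[OF assms]) auto
qed

text \<open>Pick a finite set that almost attains the variation up to \<open>x + 1\<close>, and a point \<open>z > x\<close> which is below
  all points of this set beyond \<open>x\<close> and at which \<open>g\<close> is close to \<open>g x\<close>. After insertion of \<open>x\<close> and \<open>z\<close>,
  the part between them contributes little, and the part beyond \<open>z\<close> is at most the variation from \<open>z\<close>
  to \<open>x + 1\<close>. So hardly any variation is left between \<open>x\<close> and \<open>z\<close>.\<close>

lemma continuous_at_right_total_variation:
  assumes bv: "bounded_variation_on g UNIV" and g: "continuous (at_right x) g"
  shows "continuous (at_right x) (\<lambda>x. total_variation g {..x})"
proof -
  define V where "V x = total_variation g {..x}" for x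
  have mono: "V y \<le> V z" if "y \<le> z" for y z
    using abs_diff_le_total_variation[OF bv that] by (simp add: V_def)
  have ex: "\<exists>z>x. V z \<le> V x + e" if e: "e > 0" for e
  proof -
    have "\<exists>D\<in>{D. finite D \<and> D \<subseteq> {..x + 1}}. V (x + 1) - e / 2 < variation_sum g D"
      unfolding V_def total_variation_def[of g "{..x + 1}"] using e
      by (intro less_cSUP_iff[THEN iffD1])
        (use bv in \<open>auto simp: bounded_variation_on_def intro: bdd_above_mono\<close>)
    then obtain D where D: "finite D" "D \<subseteq> {..x + 1}" "V (x + 1) - e / 2 < variation_sum g D"
      by auto
    have "(g \<longlongrightarrow> g x) (at_right x)" using g by (simp add: continuous_within)
    then have "\<forall>\<^sub>F z in at_right x. dist (g z) (g x) < e / 2"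
      using e by (intro tendstoD) auto
    moreover have "\<forall>\<^sub>F z in at_right x. z < Min (insert (x + 1) (D \<inter> {x<..}))"
      using D(1) by (intro order_tendstoD(2)[of "\<lambda>z. z"] tendsto_ident_at) auto
    moreover have "\<forall>\<^sub>F z in at_right x. x < z"
      by (simp add: eventually_at_filter)
    ultimately have "\<forall>\<^sub>F z in at_right x. dist (g z) (g x) < e / 2 \<and>
        z < Min (insert (x + 1) (D \<inter> {x<..})) \<and> x < z"
      by eventually_elim simp
    then obtain z where z: "\<bar>g z - g x\<bar> < e / 2" "x < z" "z < x + 1"
      and zD: "\<And>d. d \<in> D \<Longrightarrow> x < d \<Longrightarrow> z < d"
      using eventually_happens[of _ "at_right x"] D(1)
      by (force simp: dist_real_def)
    define E where "E = insert x (insert z D)"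
    have E: "finite E" "x \<in> E" "z \<in> E" using D by (auto simp: E_def)
    have "variation_sum g D \<le> variation_sum g E"
      unfolding E_def using D(1) by (meson variation_sum_insert finite_insert order.trans)
    also have "\<dots> = variation_sum g (E \<inter> {..x}) + variation_sum g (E \<inter> {x..})"
      by (rule variation_sum_split) (use E in auto)
    also have "variation_sum g (E \<inter> {x..}) = \<bar>g z - g x\<bar> + variation_sum g (E \<inter> {z..})"
    proof -
      have "E \<inter> {x..} \<inter> {..z} = {x, z}" "E \<inter> {x..} \<inter> {z..} = E \<inter> {z..}"
        using z zD by (force simp: E_def)+
      then show ?thesis using variation_sum_split[of "E \<inter> {x..}" z g] E z
        by (simp add: variation_sum_def consecutive_pair)
    qed
    finally have "variation_sum g D \<le> variation_sum g (E \<inter> {..x})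
      + (\<bar>g z - g x\<bar> + variation_sum g (E \<inter> {z..}))" .
    moreover have "variation_sum g (E \<inter> {..x}) \<le> V x"
      unfolding V_def by (rule variation_sum_le_total_variation[OF bv]) (use E in auto)
    moreover have "V z + variation_sum g (E \<inter> {z..}) \<le> V (x + 1)"
      unfolding V_def
      by (rule total_variation_superadditive[OF bv]) (use E D z in \<open>auto simp: E_def\<close>)
    ultimately have "V z \<le> V x + e" using z(1) D(3) by linarith
    then show ?thesis using z by auto
  qed
  have "(V \<longlongrightarrow> V x) (at_right x)"
  proof (rule tendstoI)
    fix e :: real assume "e > 0"
    then obtain z where z: "z > x" "V z \<le> V x + e / 2" using ex[of "e / 2"] by auto
    have "dist (V y) (V x) < e" if "x < y" "y < z" for y
      using mono[of x y] mono[of y z] that z \<open>e > 0\<close> by (simp add: dist_real_def)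
    then show "\<forall>\<^sub>F y in at_right x. dist (V y) (V x) < e"
      unfolding eventually_at_right_field using z by auto
  qed
  then show ?thesis by (simp add: continuous_within V_def[abs_def])
qed

lemma finite_measure_interval_measure:
  fixes F :: "real \<Rightarrow> real"
  assumes mono: "\<And>x y. x \<le> y \<Longrightarrow> F x \<le> F y" and cont: "\<And>a. continuous (at_right a) F"
    and bd: "\<And>x. \<bar>F x\<bar> \<le> B"
  shows "finite_measure (interval_measure F)"
proof
  have "emeasure (interval_measure F) (\<Union>n. {- real n<..real n})
      = (SUP n. emeasure (interval_measure F) {- real n<..real n})"
    by (intro SUP_emeasure_incseq[symmetric]) (auto simp: incseq_def)
  also have "(\<Union>n. {- real n<..real n}) = UNIV"
  proof (intro equalityI subsetI UNIV_I)
    fix x :: real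
    obtain n where "\<bar>x\<bar> < real n" using reals_Archimedean2 by blast
    then show "x \<in> (\<Union>n. {- real n<..real n})" by (intro UN_I[of n]) auto
  qed
  finally have *: "emeasure (interval_measure F) UNIV
      = (SUP n. emeasure (interval_measure F) {- real n<..real n})" .
  have "emeasure (interval_measure F) UNIV \<le> ennreal (2 * B)"
  proof -
    have "F (real n) - F (- real n) \<le> 2 * B" for n
      using bd[of "real n"] bd[of "- real n"] by linarith
    with * show ?thesis
      by (auto intro!: SUP_least ennreal_leI simp: emeasure_interval_measure_Ioc[OF _ mono cont])
  qed
  then show "emeasure (interval_measure F) (space (interval_measure F)) \<noteq> \<infinity>"
    by (simp add: top_unique) (metis ennreal_less_top infinity_ennreal_def leD)
qed

section \<open>Integration against the Jordan decomposition\<close>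

text \<open>The two monotone functions of the Jordan decomposition are those for \<open>s = 1\<close> and \<open>s = -1\<close>; the parameter
  lets one proof serve both.\<close>

definition Jordan_part :: "real \<Rightarrow> (real \<Rightarrow> real) \<Rightarrow> real \<Rightarrow> real" where
  "Jordan_part s g x = (total_variation g {..x} + s * g x) / 2"

lemma stieltjes_integral_Jordan:
  "stieltjes_integral h g = (\<integral>x. h x \<partial>interval_measure (Jordan_part 1 g))
     - (\<integral>x. h x \<partial>interval_measure (Jordan_part (-1) g))"
  by (simp add: stieltjes_integral_def Jordan_part_def[abs_def])

lemma Jordan_part_diff: "Jordan_part 1 g x - Jordan_part (-1) g x = g x"
  by (simp add: Jordan_part_def field_simps)

lemma bounded_variation_imp_bounded:
  assumes "bounded_variation_on g UNIV"
  obtains B where "\<And>x. \<bar>g x\<bar> \<le> B"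
proof
  fix x :: real
  have "\<bar>g x - g 0\<bar> \<le> total_variation g UNIV"
  proof (cases "0 \<le> x")
    case True
    then show ?thesis
      using abs_diff_le_total_variation[OF assms True] total_variation_bounds[OF assms, of x]
        total_variation_bounds[OF assms, of 0] by linarith
  next
    case False
    then show ?thesis
      using abs_diff_le_total_variation[OF assms, of x 0] total_variation_bounds[OF assms, of x]
        total_variation_bounds[OF assms, of 0] by linarith
  qed
  then show "\<bar>g x\<bar> \<le> \<bar>g 0\<bar> + total_variation g UNIV" by linarith
qed

context
  fixes g :: "real \<Rightarrow> real"
  assumes rc: "\<forall>x. continuous (at_right x) g" and bv: "bounded_variation_on g UNIV"
begin

lemma Jordan_part_mono: "\<bar>s\<bar> \<le> 1 \<Longrightarrow> x \<le> y \<Longrightarrow> Jordan_part s g x \<le> Jordan_part s g y"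
proof -
  assume s: "\<bar>s\<bar> \<le> 1" and xy: "x \<le> y"
  have "\<bar>s * (g x - g y)\<bar> \<le> 1 * \<bar>g y - g x\<bar>"
    unfolding abs_mult abs_minus_commute[of "g y"] using s by (rule mult_right_mono) simp
  also have "\<dots> \<le> total_variation g {..y} - total_variation g {..x}"
    using abs_diff_le_total_variation[OF bv xy] by simp
  finally show ?thesis by (simp add: Jordan_part_def algebra_simps)
qed

lemma Jordan_part_right_continuous: "continuous (at_right x) (Jordan_part s g)"
  unfolding Jordan_part_def[abs_def] using rc
  by (intro continuous_intros continuous_at_right_total_variation[OF bv]) auto

lemma finite_measure_Jordan:
  assumes "\<bar>s\<bar> \<le> 1"
  shows "finite_measure (interval_measure (Jordan_part s g))"
proof -
  obtain B where B: "\<And>x. \<bar>g x\<bar> \<le> B" using bounded_variation_imp_bounded[OF bv] by blast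
  have "\<bar>Jordan_part s g x\<bar> \<le> total_variation g UNIV + B" for x
  proof -
    have "\<bar>s * g x\<bar> \<le> 1 * B" unfolding abs_mult using assms B[of x] by (intro mult_mono) auto
    then show ?thesis
      using total_variation_bounds[OF bv, of x]
      unfolding Jordan_part_def abs_le_iff by (simp add: field_simps)
  qed
  then show ?thesis
    using finite_measure_interval_measure[OF Jordan_part_mono[OF assms] Jordan_part_right_continuous]
    by blast
qed

lemma borel_measurable_bounded_variation: "g \<in> borel_measurable borel"
proof -
  have "Jordan_part s g \<in> borel_measurable borel" if "\<bar>s\<bar> \<le> 1" for s
    using Jordan_part_mono[OF that] by (intro borel_measurable_mono monoI) auto
  then have "(\<lambda>x. Jordan_part 1 g x - Jordan_part (-1) g x) \<in> borel_measurable borel"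
    by (intro borel_measurable_diff) auto
  then show ?thesis by (simp add: Jordan_part_diff)
qed

lemma stieltjes_integral_sum:
  assumes "\<And>i. i \<in> I \<Longrightarrow> h i \<in> borel_measurable borel"
    and "\<And>i. i \<in> I \<Longrightarrow> \<exists>B. \<forall>x. \<bar>h i x\<bar> \<le> B"
  shows "stieltjes_integral (\<lambda>x. \<Sum>i\<in>I. h i x) g = (\<Sum>i\<in>I. stieltjes_integral (h i) g)"
proof -
  have "integrable (interval_measure (Jordan_part s g)) (h i)" if "i \<in> I" "\<bar>s\<bar> \<le> 1" for s i
  proof -
    interpret finite_measure "interval_measure (Jordan_part s g)"
      using that by (intro finite_measure_Jordan)
    obtain B where "\<forall>x. \<bar>h i x\<bar> \<le> B" using assms(2)[OF \<open>i \<in> I\<close>] by blast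
    then show ?thesis using assms that by (intro integrable_const_bound[of _ B]) auto
  qed
  then show ?thesis
    by (simp add: stieltjes_integral_Jordan sum_subtractf)
qed

text \<open>From some index on, the functions are within distance 1 of their limit, hence bounded by one common
  constant, which is integrable for both finite measures.\<close>

lemma tendsto_stieltjes_integral:
  assumes m: "\<And>n. h n \<in> borel_measurable borel" and bd: "\<And>n. \<exists>B. \<forall>x. \<bar>h n x\<bar> \<le> B"
    and lim: "uniform_limit UNIV h l sequentially"
  shows "(\<lambda>n. stieltjes_integral (h n) g) \<longlonglongrightarrow> stieltjes_integral l g"
proof -
  have pt: "(\<lambda>n. h n x) \<longlonglongrightarrow> l x" for x
    by (rule tendsto_uniform_limitI[OF lim UNIV_I])
  then have ml: "l \<in> borel_measurable borel"
    by (rule borel_measurable_LIMSEQ_real) (rule m)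
  have "\<forall>\<^sub>F n in sequentially. \<forall>x\<in>UNIV. dist (h n x) (l x) < 1"
    using lim by (auto simp: uniform_limit_iff)
  then obtain N where N: "\<And>n x. n \<ge> N \<Longrightarrow> \<bar>h n x - l x\<bar> < 1"
    by (auto simp: eventually_sequentially dist_real_def)
  obtain B where B: "\<And>x. \<bar>h N x\<bar> \<le> B" using bd by blast
  have bound: "\<bar>h (n + N) x\<bar> \<le> B + 2" for n x
    using N[of N x] N[of "n + N" x] B[of x] by linarith
  have "(\<lambda>n. \<integral>x. h n x \<partial>interval_measure (Jordan_part s g))
      \<longlonglongrightarrow> (\<integral>x. l x \<partial>interval_measure (Jordan_part s g))" if s: "\<bar>s\<bar> \<le> 1" for s
  proof -
    interpret finite_measure "interval_measure (Jordan_part s g)"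
      using s by (intro finite_measure_Jordan)
    have "(\<lambda>n. \<integral>x. h (n + N) x \<partial>interval_measure (Jordan_part s g))
      \<longlonglongrightarrow> (\<integral>x. l x \<partial>interval_measure (Jordan_part s g))"
      by (rule integral_dominated_convergence[where w = "\<lambda>_. B + 2"])
        (use m ml bound LIMSEQ_ignore_initial_segment[OF pt] in auto)
    then show ?thesis by (rule LIMSEQ_offset)
  qed
  then show ?thesis
    unfolding stieltjes_integral_Jordan by (intro tendsto_diff) auto
qed

end

lemma Taylor_remainder_interval_measure:
  assumes mono: "\<And>x y. x \<le> y \<Longrightarrow> F x \<le> F y" and cont: "\<And>a. continuous (at_right a) F"
  shows "Taylor_remainder (interval_measure F) a 0 b = F b - F a"
proof -
  have *: "(\<integral>y. indicator {c<..d} y \<partial>interval_measure F) = F d - F c" if "c \<le> d" for c d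
    by (simp add: measure_interval_measure_Ioc[OF that mono cont])
  show ?thesis
  proof (cases "a \<le> b")
    case True
    then have "oriented a b = indicator {a<..b}"
      by (auto simp: fun_eq_iff oriented_eq indicator_def)
    then show ?thesis using *[OF True] by (simp add: Taylor_remainder_def)
  next
    case False
    then have "oriented a b = (\<lambda>x. - indicator {b<..a} x)"
      by (auto simp: fun_eq_iff oriented_eq indicator_def)
    then show ?thesis using *[of b a] False by (simp add: Taylor_remainder_def)
  qed
qed

section \<open>Expansion of the function along one interval\<close>

text \<open>If \<open>b < a\<close>, then the orientation is negative and so is the odd power of \<open>b - y\<close>. The local
  times use the power \<open>q = p - 1\<close>, which is odd because \<open>p\<close> is even.\<close>

lemma oriented_odd_power:
  assumes "odd q"
  shows "oriented a b y * (b - y) ^ q = indicator {min a b<..max a b} y * \<bar>b - y\<bar> ^ q"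
proof (cases "a \<le> b")
  case True
  then show ?thesis by (auto simp: oriented_eq indicator_def)
next
  case False
  have "- ((b - y) ^ q) = \<bar>b - y\<bar> ^ q" if "b < y"
    using power_minus_odd[OF assms, of "b - y"] that by simp
  then show ?thesis using False by (auto simp: oriented_eq indicator_def)
qed

lemma C_diff_has_derivative:
  assumes "C_diff m f" "k < m"
  shows "((deriv ^^ k) f has_real_derivative (deriv ^^ Suc k) f x) (at x)"
proof -
  have "(deriv ^^ k) f differentiable (at x)" using assms by (auto simp: C_diff_def)
  then show ?thesis by (simp add: DERIV_deriv_iff_real_differentiable)
qed

lemma C_diff_continuous:
  assumes "C_diff m f" "k \<le> m"
  shows "continuous_on UNIV ((deriv ^^ k) f)"
proof (cases "k = m")
  case False
  then have "k < m" using assms by simp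
  then show ?thesis
    using C_diff_has_derivative[OF assms(1)]
    by (blast intro: continuous_at_imp_continuous_on DERIV_isCont)
qed (use assms in \<open>auto simp: C_diff_def\<close>)

text \<open>The contribution to the discrete local time of one interval along which the path moves from \<open>a\<close> to \<open>b\<close>.\<close>

definition local_time_kernel :: "nat \<Rightarrow> real \<Rightarrow> real \<Rightarrow> real \<Rightarrow> real" where
  "local_time_kernel p a b x = indicator {min a b<..max a b} x * \<bar>b - x\<bar> ^ (p - 1)"

lemma local_time_kernel_measurable [measurable]:
  "local_time_kernel p a b \<in> borel_measurable borel"
  unfolding local_time_kernel_def[abs_def] by measurable

lemma local_time_kernel_bounded: "\<bar>local_time_kernel p a b x\<bar> \<le> \<bar>b - a\<bar> ^ (p - 1)"
  by (auto simp: local_time_kernel_def split: split_indicator intro!: power_mono)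

text \<open>The general expansion, applied to the derivatives \<open>g, f\<^sup>(\<^sup>p\<^sup>-\<^sup>2\<^sup>), \<dots>, f', f\<close>. The step from \<open>g\<close> to
  \<open>f\<^sup>(\<^sup>p\<^sup>-\<^sup>2\<^sup>)\<close> is the weak derivative; all later steps are the fundamental theorem of calculus for
  continuously differentiable functions.\<close>

lemma Taylor_formula_local_time_kernel:
  assumes p: "even p" "p > 0" and f: "C_diff (p - 2) f"
    and wd: "weak_derivative ((deriv ^^ (p - 2)) f) g"
    and rc: "\<forall>x. continuous (at_right x) g" and bv: "bounded_variation_on g UNIV"
  shows "f b - f a = (\<Sum>k = 1..p - 1. derivative_of_order p f g k a / fact k * (b - a) ^ k)
    + 1 / fact (p - 1) * stieltjes_integral (local_time_kernel p a b) g"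
proof -
  obtain q where q: "p = Suc q" "odd q" using p by (cases p) auto
  then have q1: "q \<ge> 1" by (cases q) auto
  let ?M = "\<lambda>s. interval_measure (Jordan_part s g)"
  define D where "D i = derivative_of_order p f g (q - i)" for i
  have D0: "D 0 = g" by (simp add: D_def derivative_of_order_def q)
  have DS: "D i = (deriv ^^ (q - i)) f" if "0 < i" "i \<le> q" for i
    using that by (auto simp: D_def derivative_of_order_def q)
  have Dq: "D q = f" using DS[of q] q1 by simp
  have "D q b = (\<Sum>k\<le>q. D (q - k) a / fact k * (b - a) ^ k)
      + (Taylor_remainder (?M 1) a q b - Taylor_remainder (?M (-1)) a q b) / fact q"
  proof (rule Taylor_formula_Stieltjes)
    show "finite_measure (?M 1)" "finite_measure (?M (-1))"
      by (auto intro: finite_measure_Jordan[OF rc bv])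
    have "Taylor_remainder (?M s) a 0 b = Jordan_part s g b - Jordan_part s g a" if "\<bar>s\<bar> \<le> 1" for s a b
      by (rule Taylor_remainder_interval_measure)
        (use Jordan_part_mono[OF rc bv that] Jordan_part_right_continuous[OF rc bv] in auto)
    then show "D 0 b - D 0 a = Taylor_remainder (?M 1) a 0 b - Taylor_remainder (?M (-1)) a 0 b" for a b
      using Jordan_part_diff[of g a] Jordan_part_diff[of g b] by (simp add: D0)
    show "has_bochner_integral lborel (\<lambda>x. oriented a b x * D i x) (D (Suc i) b - D (Suc i) a)"
      if i: "i < q" for i a b
    proof (cases "i = 0")
      case True
      obtain B where "\<And>x. \<bar>g x\<bar> \<le> B" using bounded_variation_imp_bounded[OF bv] by blast
      then have "has_bochner_integral lborel (\<lambda>x. oriented a b x * g x)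
          ((deriv ^^ (p - 2)) f b - (deriv ^^ (p - 2)) f a)"
        using weak_derivative_increment[OF wd C_diff_continuous[OF f order.refl]
            borel_measurable_bounded_variation[OF rc bv]] by blast
      moreover have "D (Suc i) = (deriv ^^ (p - 2)) f"
        using DS[of "Suc i"] q1 True by (simp add: q numeral_2_eq_2)
      ultimately show ?thesis using True by (simp add: D0)
    next
      case False
      define k where "k = q - Suc i"
      have k: "q - i = Suc k" "k < p - 2" using i False q1 by (auto simp: k_def q)
      have "D i = (deriv ^^ Suc k) f" "D (Suc i) = (deriv ^^ k) f"
        using i False DS[of i] DS[of "Suc i"] k by (auto simp: k_def)
      then show ?thesis
        using C_diff_has_derivative[OF f k(2)] C_diff_continuous[OF f, of "Suc k"] k(2)
        by (intro has_bochner_integral_oriented_FTC) auto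
    qed
  qed auto
  moreover have "Taylor_remainder (?M 1) a q b - Taylor_remainder (?M (-1)) a q b
      = stieltjes_integral (local_time_kernel p a b) g"
    unfolding stieltjes_integral_Jordan Taylor_remainder_def local_time_kernel_def
    by (simp add: oriented_odd_power[OF q(2)] q(1))
  moreover have "(\<Sum>k\<le>q. D (q - k) a / fact k * (b - a) ^ k)
      = f a + (\<Sum>k = 1..q. derivative_of_order p f g k a / fact k * (b - a) ^ k)"
  proof -
    have "(\<Sum>k\<le>q. D (q - k) a / fact k * (b - a) ^ k)
      = D q a + (\<Sum>k = 1..q. D (q - k) a / fact k * (b - a) ^ k)"
      by (simp add: atMost_atLeast0 sum.atLeast_Suc_atMost)
    also have "(\<Sum>k = 1..q. D (q - k) a / fact k * (b - a) ^ k)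
      = (\<Sum>k = 1..q. derivative_of_order p f g k a / fact k * (b - a) ^ k)"
      by (intro sum.cong) (auto simp: D_def)
    finally show ?thesis by (simp add: Dq)
  qed
  ultimately show ?thesis by (simp add: Dq q(1))
qed

section \<open>Telescoping along partitions\<close>

text \<open>The intervals that start no later than \<open>t\<close> are those of the partition truncated at the right end \<open>w\<close>
  of an interval containing \<open>t\<close>. For \<open>t < T\<close> the first point beyond \<open>t\<close> does it; at \<open>t = T\<close> there is
  none, and the last interval, with \<open>w = T\<close>, takes over.\<close>

lemma consecutive_up_to_time:
  assumes P: "interval_partition T P" and T: "0 < T" and t: "t \<in> {0..T}"
  obtains u w where "(u, w) \<in> consecutive P" "t \<in> {u..w}"
    "{(u, v) \<in> consecutive P. u \<le> t} = consecutive (P \<inter> {..w})"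
proof -
  have fin: "finite P" and 0: "0 \<in> P" and TP: "T \<in> P" and sub: "P \<subseteq> {0..T}"
    using P by (auto simp: interval_partition_def)
  show thesis
  proof (cases "t < T")
    case True
    let ?u = "Max (P \<inter> {..t})" and ?w = "Min (P \<inter> {t<..})"
    have u: "?u \<in> P \<inter> {..t}" by (rule Max_in) (use fin 0 t in auto)
    have w: "?w \<in> P \<inter> {t<..}" by (rule Min_in) (use fin TP True in auto)
    have le_u: "z \<le> ?u" if "z \<in> P" "z \<le> t" for z using that fin by (intro Max_ge) auto
    have ge_w: "?w \<le> z" if "z \<in> P" "t < z" for z using that fin by (intro Min_le) auto
    show thesis
    proof (rule that[of ?u ?w])
      have "P \<inter> {?u<..<?w} = {}" using le_u ge_w by (fastforce simp: not_le[symmetric])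
      then show "(?u, ?w) \<in> consecutive P" using u w by (auto simp: consecutive_def)
      show "t \<in> {?u..?w}" using u w by auto
      have "v \<le> ?w" if "(u, v) \<in> consecutive P" "u \<le> t" for u v
        using that w by (force simp: consecutive_def)
      moreover have "u \<le> t" if "u \<in> P" "u < ?w" for u
        using ge_w[of u] that by force
      ultimately show "{(u, v) \<in> consecutive P. u \<le> t} = consecutive (P \<inter> {..?w})"
        by (fastforce simp: consecutive_def)
    qed
  next
    case False
    then have tT: "t = T" using t by simp
    let ?u = "Max (P \<inter> {..<T})"
    have u: "?u \<in> P \<inter> {..<T}" by (rule Max_in) (use fin 0 T in auto)
    have le_u: "z \<le> ?u" if "z \<in> P" "z < T" for z using that fin by (intro Max_ge) auto
    show thesis
    proof (rule that[of ?u T])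
      have "P \<inter> {?u<..<T} = {}" using le_u by fastforce
      then show "(?u, T) \<in> consecutive P" using u TP by (auto simp: consecutive_def)
      show "t \<in> {?u..T}" using u tT by auto
      have "P \<inter> {..T} = P" using sub by auto
      then show "{(u, v) \<in> consecutive P. u \<le> t} = consecutive (P \<inter> {..T})"
        using sub tT by (auto simp: consecutive_def)
    qed
  qed
qed

lemma abs_increment_le_osc:
  assumes P: "interval_partition T P" and S: "continuous_on {0..T} S"
    and uv: "(u, v) \<in> consecutive P" and rs: "r \<in> {u..v}" "s \<in> {u..v}"
  shows "\<bar>S s - S r\<bar> \<le> osc S P"
proof -
  have fin: "finite P" and sub: "{u..v} \<subseteq> {0..T}"
    using P uv by (auto simp: interval_partition_def consecutive_def)
  have "compact (S ` {u..v})"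
    by (intro compact_continuous_image continuous_on_subset[OF S] sub) auto
  then obtain B where B: "\<And>x. x \<in> {u..v} \<Longrightarrow> \<bar>S x\<bar> \<le> B"
    by (force dest!: compact_imp_bounded simp: bounded_iff)
  have "bdd_above ((\<lambda>(r, s). \<bar>S s - S r\<bar>) ` ({u..v} \<times> {u..v}))"
  proof (rule bdd_aboveI[of _ "2 * B"])
    fix x assume "x \<in> (\<lambda>(r, s). \<bar>S s - S r\<bar>) ` ({u..v} \<times> {u..v})"
    then obtain r s where "x = \<bar>S s - S r\<bar>" "r \<in> {u..v}" "s \<in> {u..v}" by auto
    then show "x \<le> 2 * B" using B[of r] B[of s] by linarith
  qed
  then have "\<bar>S s - S r\<bar> \<le> (SUP (r, s) \<in> {u..v} \<times> {u..v}. \<bar>S s - S r\<bar>)"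
    using cSUP_upper[of "(r, s)" "{u..v} \<times> {u..v}" "\<lambda>(r, s). \<bar>S s - S r\<bar>"] rs by simp
  also have "\<dots> \<le> osc S P"
    unfolding osc_def
    by (rule Max_ge) (use fin uv in \<open>auto intro!: image_eqI[of _ _ "(u, v)"]\<close>)
  finally show ?thesis .
qed

lemma tendsto_sum_increments_up_to_time:
  fixes h :: "real \<Rightarrow> real"
  assumes P: "\<And>n. interval_partition T (\<pi> n)" and T: "0 < T" and t: "t \<in> {0..T}"
    and S: "continuous_on {0..T} S" and osc: "(\<lambda>n. osc S (\<pi> n)) \<longlonglongrightarrow> 0"
    and h: "isCont h (S t)"
  shows "(\<lambda>n. \<Sum>(u, v) \<in> {(u, v) \<in> consecutive (\<pi> n). u \<le> t}. h (S v) - h (S u))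
    \<longlonglongrightarrow> h (S t) - h (S 0)"
proof -
  \<comment> \<open>The telescoped sum ends at a point \<open>w\<close> in the same partition interval as \<open>t\<close>.\<close>
  have "\<exists>w. \<bar>S w - S t\<bar> \<le> osc S (\<pi> n) \<and>
      (\<Sum>(u, v) \<in> {(u, v) \<in> consecutive (\<pi> n). u \<le> t}. h (S v) - h (S u)) = h (S w) - h (S 0)" for n
  proof -
    obtain u w where uw: "(u, w) \<in> consecutive (\<pi> n)" "t \<in> {u..w}"
      and *: "{(u, v) \<in> consecutive (\<pi> n). u \<le> t} = consecutive (\<pi> n \<inter> {..w})"
      using consecutive_up_to_time[OF P T t] by blast
    have P': "finite (\<pi> n)" "0 \<in> \<pi> n" "\<pi> n \<subseteq> {0..T}"
      using P[of n] by (auto simp: interval_partition_def)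
    have w: "w \<in> \<pi> n" "0 \<le> w" using uw P' by (auto simp: consecutive_def)
    have "Max (\<pi> n \<inter> {..w}) = w" "Min (\<pi> n \<inter> {..w}) = 0"
      using P' w by (auto intro!: Max_eqI Min_eqI)
    moreover have "\<pi> n \<inter> {..w} \<noteq> {}" using w by auto
    ultimately have "(\<Sum>(u, v) \<in> consecutive (\<pi> n \<inter> {..w}). h (S v) - h (S u)) = h (S w) - h (S 0)"
      using sum_consecutive_telescope[of "\<pi> n \<inter> {..w}" "\<lambda>x. h (S x)"] P' by simp
    moreover have "\<bar>S w - S t\<bar> \<le> osc S (\<pi> n)"
      by (rule abs_increment_le_osc[OF P S uw(1)]) (use uw in \<open>auto simp: consecutive_def\<close>)
    ultimately show ?thesis unfolding * by blast
  qed
  then obtain w where w: "\<And>n. \<bar>S (w n) - S t\<bar> \<le> osc S (\<pi> n)"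
    and sum: "\<And>n. (\<Sum>(u, v) \<in> {(u, v) \<in> consecutive (\<pi> n). u \<le> t}. h (S v) - h (S u))
      = h (S (w n)) - h (S 0)"
    by metis
  have "(\<lambda>n. S (w n) - S t) \<longlonglongrightarrow> 0"
    by (rule Lim_null_comparison[OF _ osc]) (simp add: w)
  then have "(\<lambda>n. S (w n)) \<longlonglongrightarrow> S t" by (simp add: LIM_zero_iff)
  then have "(\<lambda>n. h (S (w n)) - h (S 0)) \<longlonglongrightarrow> h (S t) - h (S 0)"
    by (intro tendsto_intros isCont_tendsto_compose[OF h])
  then show ?thesis by (simp add: sum)
qed

section \<open>The change of variables formula\<close>

lemma discrete_local_time_eq:
  "discrete_local_time P p S t
    = (\<lambda>x. \<Sum>z \<in> {(u, v) \<in> consecutive P. u \<le> t}. local_time_kernel p (S (fst z)) (S (snd z)) x)"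
  by (simp add: discrete_local_time_def local_time_kernel_def fun_eq_iff split_beta')

theorem theorem3p5:
  fixes T :: real and \<pi> :: "nat \<Rightarrow> real set" and p :: nat and f g :: "real \<Rightarrow> real"
  assumes "T > 0" and "nested_partitions T \<pi>"
    and "even p" and "p > 0"
    and "C_diff (p - 2) f"
    and "\<forall>a b. absolutely_continuous_on ((deriv ^^ (p - 2)) f) {a..b}"
    and "weak_derivative ((deriv ^^ (p - 2)) f) g"
    and "\<forall>x. continuous (at_right x) g"
    and "bounded_variation_on g UNIV"
  shows "\<forall>S \<in> continuous_local_time_paths T \<pi> p. \<forall>t \<in> {0..T}.
    convergent (\<lambda>n. compensated_sum (\<pi> n) p f g S t) \<and>
    f (S t) - f (S 0) =
      pathwise_integral \<pi> p f g S t +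
      1 / fact (p - 1) * stieltjes_integral (\<lambda>x. local_time \<pi> p S t x) g"
proof (intro ballI)
  fix S t assume S: "S \<in> continuous_local_time_paths T \<pi> p" and t: "t \<in> {0..T}"
  have P: "interval_partition T (\<pi> n)" for n
    using assms(2) by (simp add: nested_partitions_def)
  have Sc: "continuous_on {0..T} S" and osc: "(\<lambda>n. osc S (\<pi> n)) \<longlonglongrightarrow> 0"
    and L: "uniform_limit UNIV (\<lambda>n. discrete_local_time (\<pi> n) p S t) (local_time \<pi> p S t) sequentially"
    using S t by (auto simp: continuous_local_time_paths_def pth_variation_paths_def)
  let ?I = "\<lambda>n. {(u, v) \<in> consecutive (\<pi> n). u \<le> t}"
  let ?L = "\<lambda>n. stieltjes_integral (discrete_local_time (\<pi> n) p S t) g"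
  have Lm: "discrete_local_time (\<pi> n) p S t \<in> borel_measurable borel" for n
    unfolding discrete_local_time_eq by measurable
  have Lb: "\<exists>B. \<forall>x. \<bar>discrete_local_time (\<pi> n) p S t x\<bar> \<le> B" for n
  proof (intro exI allI)
    show "\<bar>discrete_local_time (\<pi> n) p S t x\<bar> \<le> (\<Sum>z\<in>?I n. \<bar>S (snd z) - S (fst z)\<bar> ^ (p - 1))" for x
      unfolding discrete_local_time_eq
      by (rule order.trans[OF sum_abs sum_mono]) (rule local_time_kernel_bounded)
  qed
  have limL: "?L \<longlonglongrightarrow> stieltjes_integral (local_time \<pi> p S t) g"
    by (rule tendsto_stieltjes_integral[OF assms(8,9) Lm Lb L])
  \<comment> \<open>Summing the expansions over the intervals gives an identity without error term.\<close>
  have "compensated_sum (\<pi> n) p f g S t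
      = (\<Sum>(u, v) \<in> ?I n. f (S v) - f (S u)) - 1 / fact (p - 1) * ?L n" for n
  proof -
    have "?L n = (\<Sum>(u, v) \<in> ?I n. stieltjes_integral (local_time_kernel p (S u) (S v)) g)"
      unfolding discrete_local_time_eq split_beta'
      by (intro stieltjes_integral_sum[OF assms(8,9)])
        (auto intro: local_time_kernel_bounded)
    moreover have "(\<Sum>k = 1..p - 1. derivative_of_order p f g k a / fact k * (b - a) ^ k)
        = f b - f a - 1 / fact (p - 1) * stieltjes_integral (local_time_kernel p a b) g" for a b
      using Taylor_formula_local_time_kernel[OF assms(3-5,7-9), of b a] by linarith
    ultimately show ?thesis
      unfolding compensated_sum_def split_beta' by (simp only: sum_subtractf sum_distrib_left)
  qed
  moreover have "(\<lambda>n. (\<Sum>(u, v) \<in> ?I n. f (S v) - f (S u)) - 1 / fact (p - 1) * ?L n)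
      \<longlonglongrightarrow> (f (S t) - f (S 0)) - 1 / fact (p - 1) * stieltjes_integral (local_time \<pi> p S t) g"
  proof (intro tendsto_intros limL tendsto_sum_increments_up_to_time[OF P assms(1) t Sc osc])
    show "isCont f (S t)"
      using C_diff_continuous[OF assms(5), of 0] by (simp add: continuous_on_eq_continuous_at)
  qed
  ultimately have lim: "(\<lambda>n. compensated_sum (\<pi> n) p f g S t)
      \<longlonglongrightarrow> (f (S t) - f (S 0)) - 1 / fact (p - 1) * stieltjes_integral (local_time \<pi> p S t) g"
    by simp
  then show "convergent (\<lambda>n. compensated_sum (\<pi> n) p f g S t) \<and>
    f (S t) - f (S 0) =
      pathwise_integral \<pi> p f g S t +
      1 / fact (p - 1) * stieltjes_integral (\<lambda>x. local_time \<pi> p S t x) g"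
    using limI[OF lim] by (auto simp: convergent_def pathwise_integral_def)
qed

end
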